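(* There is an absolute constant $K_3>0$ such that the following holds. Let $r=r(n)>0$ satisfy $r \leq K_3 \log n / \sqrt{n}$ and let $G \in \mathcal{G}(n,r)$. Then $c(G) > 1$ with probability tending to $1$ as $n\to\infty$.
   Context: $\mathcal{G}(n,r)$ denotes the random geometric graph $G(x_1,\dots,x_n;r)$ where $x_1,\dots,x_n$ are chosen independently and uniformly at random from $[0,1]^2$, and $x_i,x_j$ ($i\ne j$) are adjacent iff $\|x_i-x_j\|\le r$. Game of cops and robbers on a finite graph: cops choose starting vertices, then the robber; players alternate turns, each agent moving to an adjacent vertex or staying put (cops move simultaneously; full information); cops win if some cop eventually occupies the robber's vertex. The cop number $c(G)$ is the minimum number of cops having a strategy that wins against every robber strategy (for a disconnected graph with at least two vertices one cop cannot win). *)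

theory Defs
  imports "HOL-Probability.Probability"
begin

text \<open>Random geometric graph: vertices are the indices 0..n-1; points live in the
unit square [0,1]^2 (as real \<times> real, whose dist is the Euclidean distance).\<close>

definition rgg_adj :: "(nat \<Rightarrow> real \<times> real) \<Rightarrow> real \<Rightarrow> nat \<Rightarrow> nat \<Rightarrow> bool" where
  "rgg_adj x r i j \<longleftrightarrow> i \<noteq> j \<and> dist (x i) (x j) \<le> r"

definition unit_square :: "(real \<times> real) set" where
  "unit_square = {0..1} \<times> {0..1}"

definition rgg_space :: "nat \<Rightarrow> (nat \<Rightarrow> real \<times> real) measure" where
  "rgg_space n = PiM {..<n} (\<lambda>_. uniform_measure lborel unit_square)"

definition closed_nbhd :: "nat set \<Rightarrow> (nat \<Rightarrow> nat \<Rightarrow> bool) \<Rightarrow> nat \<Rightarrow> nat set" where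
  "closed_nbhd V E v = {w \<in> V. w = v \<or> E v w}"

text \<open>Cops and robbers with k cops on the graph (V,E).  A cop strategy sigma maps the
history of robber positions (R_0,...,R_{t-1}) to the positions of the cops 0..k-1 at
time t (cops may also use their own past positions, but these are determined by sigma
and the robber history).  Since the game is deterministic with full information, the
robber's strategies against a fixed cop strategy amount to arbitrary legal robber
walks R.  Order of play: cops at C_0, robber picks R_0, cops move to C_1, robber moves
to R_1, ...  Capture: some cop occupies the robber's vertex.\<close>
definition cops_win :: "nat set \<Rightarrow> (nat \<Rightarrow> nat \<Rightarrow> bool) \<Rightarrow> nat \<Rightarrow> bool" where
  "cops_win V E k \<longleftrightarrow>
    (\<exists>\<sigma> :: nat list \<Rightarrow> nat \<Rightarrow> nat.
       (\<forall>i<k. \<sigma> [] i \<in> V) \<and>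
       (\<forall>R :: nat \<Rightarrow> nat.
          (\<forall>t. R t \<in> V) \<and> (\<forall>t. R (Suc t) \<in> closed_nbhd V E (R t)) \<longrightarrow>
          (let C = (\<lambda>t. \<sigma> (map R [0..<t])) in
             (\<forall>t. \<forall>i<k. C (Suc t) i \<in> closed_nbhd V E (C t i)) \<and>
             (\<exists>t. \<exists>i<k. C t i = R t \<or> C (Suc t) i = R t))))"

definition cop_number :: "nat set \<Rightarrow> (nat \<Rightarrow> nat \<Rightarrow> bool) \<Rightarrow> nat" where
  "cop_number V E = (LEAST k. cops_win V E k)"

end

theory Submission
  imports Defs "HOL-Real_Asymp.Real_Asymp"
begin

text \<open>
  The robber evades a single cop if he can stay in a set \<open>S\<close> of vertices in which no vertex \<open>s\<close> is
  dominated, that is, no vertex other than \<open>s\<close> is adjacent or equal to all of \<open>N[s] \<inter> S\<close>.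
  If \<open>r \<le> 1 / sqrt n\<close>, two isolated vertices form such a set. Otherwise \<open>S\<close> consists of points
  lying very close (at distance about $r/m^2$) to the corners of a regular \<open>m\<close>-gon of side almost \<open>r\<close>,
  where \<open>m\<close> is about $(\ln n)^{3/4}$: a vertex dominating a corner lies in the lens of points
  within \<open>r\<close> of both neighbouring corners, and this lens has area only $O(r^2/m^3)$.

  Both configurations are local patterns: \<open>m\<close> small squares containing one point each, and
  an otherwise empty region of expected occupancy $O(\sqrt{\ln n})$. The pattern has probability
  $n^{-o(1)}$ at a given place, and it fits into the unit square in $n^{1-o(1)}$ disjoint
  places, so by the second moment method it occurs somewhere with probability tending to one.
\<close>

section \<open>Evading one cop\<close>

text \<open>The size of \<open>m\<close> balances two costs. Keeping the lenses empty costs a factor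
  exp(-O(n r^2 / m^2)), and n r^2 may be as large as (ln n)^2, so \<open>m\<close> has to be much
  larger than sqrt(ln n). Placing one point in each of \<open>m\<close> squares of side r / m^2
  costs m^(-O(m)), so m ln m has to be o(ln n). The exponent 3/4 lies halfway between 1/2 and 1. The
  second estimate relies on n r^2 >= 1: for smaller \<open>r\<close> such squares may be too small
  to be hit, so the range is split at 1 / sqrt n and the sparse case works at that scale whatever
  the value of \<open>r\<close>. The number of points is fixed, so patterns in disjoint boxes are
  dependent. But a pattern uses only \<open>m\<close> points and constrains a region of area at most
  \<open>q\<close>; this raises the probability of two patterns above the product by a factor of at
  most 1 / (1 - 2 m q), which tends to 1.\<close>

lemma cops_winE:
  assumes "cops_win V E k"
  obtains \<sigma> :: "nat list \<Rightarrow> nat \<Rightarrow> nat" where "\<And>i. i < k \<Longrightarrow> \<sigma> [] i \<in> V"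
    and "\<And>R t i. \<lbrakk>\<And>t. R t \<in> V; \<And>t. R (Suc t) \<in> closed_nbhd V E (R t); i < k\<rbrakk> \<Longrightarrow>
       \<sigma> (map R [0..<Suc t]) i \<in> closed_nbhd V E (\<sigma> (map R [0..<t]) i)"
    and "\<And>R. \<lbrakk>\<And>t. R t \<in> V; \<And>t. R (Suc t) \<in> closed_nbhd V E (R t)\<rbrakk> \<Longrightarrow>
       \<exists>t. \<exists>i<k. \<sigma> (map R [0..<t]) i = R t \<or> \<sigma> (map R [0..<Suc t]) i = R t"
  using assms unfolding cops_win_def Let_def by blast

text \<open>Invariant: after each robber move the robber is outside the closed neighbourhood of the
  cop. Hence the cop's reply cannot land on him, and \<open>step\<close>, applied to the cop's new
  vertex, supplies the next move. Two distinct vertices of \<open>S\<close> guarantee a safe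
  start.\<close>

lemma robber_evades_one_cop:
  assumes "S \<subseteq> V" "s0 \<in> S" "s1 \<in> S" "s0 \<noteq> s1"
    and step: "\<And>s v. s \<in> S \<Longrightarrow> v \<in> V \<Longrightarrow> v \<noteq> s \<Longrightarrow>
      \<exists>s'\<in>S. s' \<in> closed_nbhd V E s \<and> s' \<notin> closed_nbhd V E v"
  shows "\<not> cops_win V E 1"
proof
  assume "cops_win V E 1"
  then obtain \<sigma> :: "nat list \<Rightarrow> nat \<Rightarrow> nat" where start': "\<And>i. i < 1 \<Longrightarrow> \<sigma> [] i \<in> V"
    and legal': "\<And>R t i. \<lbrakk>\<And>t. R t \<in> V; \<And>t. R (Suc t) \<in> closed_nbhd V E (R t); i < 1\<rbrakk> \<Longrightarrow>
       \<sigma> (map R [0..<Suc t]) i \<in> closed_nbhd V E (\<sigma> (map R [0..<t]) i)"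
    and caught': "\<And>R. \<lbrakk>\<And>t. R t \<in> V; \<And>t. R (Suc t) \<in> closed_nbhd V E (R t)\<rbrakk> \<Longrightarrow>
       \<exists>t. \<exists>i<1. \<sigma> (map R [0..<t]) i = R t \<or> \<sigma> (map R [0..<Suc t]) i = R t"
    by (rule cops_winE) blast
  have start: "\<sigma> [] 0 \<in> V" by (rule start') simp
  \<comment> \<open>The guard makes the choice total: if \<open>v\<close> is outside
    \<open>V\<close> or equals \<open>s\<close>, staying at \<open>s\<close> is a witness. So the
    robber's walk is legal before anything is known about the cop.\<close>
  define nxt where "nxt s v = (SOME s'. s' \<in> S \<and> s' \<in> closed_nbhd V E s \<and>
    (v \<in> V \<and> v \<noteq> s \<longrightarrow> s' \<notin> closed_nbhd V E v))" for s v
  have nxt: "nxt s v \<in> S \<and> nxt s v \<in> closed_nbhd V E s \<and>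
    (v \<in> V \<and> v \<noteq> s \<longrightarrow> nxt s v \<notin> closed_nbhd V E v)" if "s \<in> S" for s v
    unfolding nxt_def
  proof (rule someI_ex, cases "v \<in> V \<and> v \<noteq> s")
    case True
    then show "\<exists>s'. s' \<in> S \<and> s' \<in> closed_nbhd V E s \<and>
      (v \<in> V \<and> v \<noteq> s \<longrightarrow> s' \<notin> closed_nbhd V E v)"
      using step[OF that] by blast
  next
    case False
    then show "\<exists>s'. s' \<in> S \<and> s' \<in> closed_nbhd V E s \<and>
      (v \<in> V \<and> v \<noteq> s \<longrightarrow> s' \<notin> closed_nbhd V E v)"
      using that \<open>S \<subseteq> V\<close> by (auto simp: closed_nbhd_def)
  qed
  \<comment> \<open>The cop occupies at most one of \<open>s0\<close> and \<open>s1\<close>;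
    \<open>step\<close> at the other one yields a vertex that he does not dominate.\<close>
  obtain r0 where r0: "r0 \<in> S" "r0 \<notin> closed_nbhd V E (\<sigma> [] 0)"
  proof (cases "\<sigma> [] 0 = s0")
    case True
    then have "\<sigma> [] 0 \<noteq> s1" using \<open>s0 \<noteq> s1\<close> by simp
    from step[OF \<open>s1 \<in> S\<close> start this] that show ?thesis by blast
  next
    case False
    from step[OF \<open>s0 \<in> S\<close> start this] that show ?thesis by blast
  qed
  \<comment> \<open>The recursion runs over histories, since \<open>\<sigma>\<close> sees all
    earlier robber positions: \<open>H t\<close> lists \<open>R 0\<close> to \<open>R t\<close>, and
    \<open>\<sigma> (H t) 0\<close> is the cop's reply to it, that is
    \<open>C (Suc t)\<close>.\<close>
  define H where "H = rec_nat [r0] (\<lambda>_ h. h @ [nxt (last h) (\<sigma> h 0)])"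
  define R where "R t = last (H t)" for t
  have H_Suc: "H (Suc t) = H t @ [nxt (R t) (\<sigma> (H t) 0)]" for t
    by (simp add: H_def R_def)
  have R_Suc: "R (Suc t) = nxt (R t) (\<sigma> (H t) 0)" for t
    using H_Suc[of t] by (simp add: R_def)
  have H_map: "H t = map R [0..<Suc t]" for t
  proof (induction t)
    case 0
    then show ?case by (simp add: H_def R_def)
  next
    case (Suc t)
    then show ?case using H_Suc[of t] R_Suc[of t] by simp
  qed
  define C where "C t = \<sigma> (map R [0..<t]) 0" for t
  have R_Suc': "R (Suc t) = nxt (R t) (C (Suc t))" for t
    using R_Suc[of t] unfolding H_map C_def .
  have RS: "R t \<in> S" for t
  proof (induction t)
    case 0
    then show ?case using r0 by (simp add: R_def H_def)
  next
    case (Suc t)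
    then show ?case using nxt by (simp add: R_Suc')
  qed
  have RV: "R t \<in> V" for t using RS \<open>S \<subseteq> V\<close> by blast
  have R_legal: "R (Suc t) \<in> closed_nbhd V E (R t)" for t
    using nxt[OF RS] by (simp add: R_Suc')
  have legal: "C (Suc t) \<in> closed_nbhd V E (C t)" for t
    unfolding C_def by (rule legal'[of R, OF RV R_legal]) simp
  have caught: "\<exists>t. C t = R t \<or> C (Suc t) = R t"
    using caught'[of R, OF RV R_legal] unfolding C_def less_one by metis
  have CV: "C t \<in> V" for t
    by (cases t) (use start legal in \<open>auto simp: C_def closed_nbhd_def\<close>)
  have safe: "R t \<notin> closed_nbhd V E (C t)" for t
  proof (induction t)
    case 0
    then show ?case using r0 by (simp add: R_def H_def C_def)
  next
    case (Suc t)
    then have "C (Suc t) \<noteq> R t" using legal[of t] by auto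
    then show ?case using nxt[OF RS, of t "C (Suc t)"] CV[of "Suc t"] by (simp add: R_Suc')
  qed
  from caught obtain t where "C t = R t \<or> C (Suc t) = R t" by blast
  then show False
  proof
    assume "C t = R t"
    then show False using safe[of t] CV[of t] by (simp add: closed_nbhd_def)
  next
    assume "C (Suc t) = R t"
    then show False using safe[of t] legal[of t] by simp
  qed
qed

text \<open>One cop on every vertex captures at once, so the \<open>LEAST\<close> is attained; it is
  not 0, since no cop captures nobody.\<close>

lemma cop_number_gt_1I:
  assumes "n > 0" "\<not> cops_win {..<n} E 1"
  shows "cop_number {..<n} E > 1"
proof -
  have "cops_win {..<n} E n"
    unfolding cops_win_def
    by (rule exI[of _ "\<lambda>_ i. i"]) (auto simp: closed_nbhd_def)
  moreover have "\<not> cops_win {..<n} E 0"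
    using \<open>n > 0\<close> unfolding cops_win_def
    by (auto simp: closed_nbhd_def intro!: exI[of _ "\<lambda>_. 0"])
  ultimately have "cops_win {..<n} E (cop_number {..<n} E)"
    unfolding cop_number_def by (metis LeastI)
  with assms(2) \<open>\<not> cops_win {..<n} E 0\<close> show ?thesis
    by (metis One_nat_def less_one linorder_neqE_nat)
qed

section \<open>Measurability of the cop number\<close>

lemma cops_win_cong:
  assumes "\<And>v w. v \<in> V \<Longrightarrow> w \<in> V \<Longrightarrow> E v w = E' v w"
  shows "cops_win V E k = cops_win V E' k"
proof -
  have *: "cops_win V E' k"
    if win: "cops_win V E k" and eq: "\<And>v w. v \<in> V \<Longrightarrow> w \<in> V \<Longrightarrow> E v w = E' v w"
    for E E' :: "nat \<Rightarrow> nat \<Rightarrow> bool"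
  proof -
    have nbhd: "closed_nbhd V E v = closed_nbhd V E' v" if "v \<in> V" for v
      using that eq by (auto simp: closed_nbhd_def)
    obtain \<sigma> :: "nat list \<Rightarrow> nat \<Rightarrow> nat" where start: "\<And>i. i < k \<Longrightarrow> \<sigma> [] i \<in> V"
      and legal: "\<And>R t i. \<lbrakk>\<And>t. R t \<in> V; \<And>t. R (Suc t) \<in> closed_nbhd V E (R t); i < k\<rbrakk> \<Longrightarrow>
         \<sigma> (map R [0..<Suc t]) i \<in> closed_nbhd V E (\<sigma> (map R [0..<t]) i)"
      and caught: "\<And>R. \<lbrakk>\<And>t. R t \<in> V; \<And>t. R (Suc t) \<in> closed_nbhd V E (R t)\<rbrakk> \<Longrightarrow>
         \<exists>t. \<exists>i<k. \<sigma> (map R [0..<t]) i = R t \<or> \<sigma> (map R [0..<Suc t]) i = R t"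
      using win by (rule cops_winE) blast
    have "(\<forall>t. \<forall>i<k. \<sigma> (map R [0..<Suc t]) i \<in> closed_nbhd V E' (\<sigma> (map R [0..<t]) i)) \<and>
         (\<exists>t. \<exists>i<k. \<sigma> (map R [0..<t]) i = R t \<or> \<sigma> (map R [0..<Suc t]) i = R t)"
      if R: "\<forall>t. R t \<in> V" "\<forall>t. R (Suc t) \<in> closed_nbhd V E' (R t)" for R
    proof -
      have RV: "R t \<in> V" for t using R by blast
      have R': "R (Suc t) \<in> closed_nbhd V E (R t)" for t
        using R nbhd by auto
      \<comment> \<open>The two graphs agree only on \<open>V\<close>, so legality transfers only
        once the cops are known to stay there.\<close>
      have "\<sigma> (map R [0..<t]) i \<in> V" if "i < k" for t i
        by (cases t) (use start legal[of R, OF RV R'] that in \<open>auto simp: closed_nbhd_def simp del: upt_Suc\<close>)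
      then show ?thesis using legal[of R, OF RV R'] caught[of R, OF RV R'] nbhd by blast
    qed
    then show ?thesis
      unfolding cops_win_def Let_def using start by blast
  qed
  show ?thesis using *[of E E'] *[of E' E] assms by blast
qed

definition sq :: "real \<times> real \<Rightarrow> real \<Rightarrow> (real \<times> real) set" where
  "sq c h = {fst c - h..fst c + h} \<times> {snd c - h..snd c + h}"

lemma mem_sq: "v \<in> sq c h \<longleftrightarrow> \<bar>fst v - fst c\<bar> \<le> h \<and> \<bar>snd v - snd c\<bar> \<le> h"
  by (cases v) (auto simp: sq_def abs_le_iff)

lemma sq_eq_cbox: "sq c h = cbox (fst c - h, snd c - h) (fst c + h, snd c + h)"
  by (auto simp: sq_def cbox_Pair_eq)

lemma sq_borel [measurable]: "sq c h \<in> sets borel"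
  by (simp add: sq_eq_cbox)

lemma emeasure_sq:
  assumes "h \<ge> 0"
  shows "emeasure lborel (sq c h) = ennreal ((2 * h)\<^sup>2)"
proof -
  have "emeasure lborel (sq c h) \<noteq> \<top>"
    using emeasure_lborel_cbox_finite by (metis less_top sq_eq_cbox infinity_ennreal_def)
  then have "emeasure lborel (sq c h) = ennreal (measure lborel (sq c h))"
    by (rule emeasure_eq_ennreal_measure)
  then show ?thesis
    using assms by (simp add: sq_eq_cbox content_Pair power2_eq_square)
qed

lemma unit_square_eq_sq: "unit_square = sq (1/2, 1/2) (1/2)"
  by (simp add: unit_square_def sq_def)

lemma emeasure_unit_square: "emeasure lborel unit_square = 1"
  by (simp add: unit_square_eq_sq emeasure_sq)

lemma prob_space_uniform_unit_square: "prob_space (uniform_measure lborel unit_square)"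
  by (rule prob_space_uniform_measure) (simp_all add: emeasure_unit_square)

text \<open>The cop number depends only on the set \<open>G\<close> of index pairs at distance at
  most \<open>r\<close>. There are finitely many such sets, and each is prescribed by finitely many
  measurable conditions on the points.\<close>

lemma rgg_cop_number_event:
  "{x \<in> space (rgg_space n). cop_number {..<n} (rgg_adj x r) > 1} \<in> sets (rgg_space n)"
proof -
  define V where "V = {..<n} \<times> {..<n}"
  define A where "A G = {x \<in> space (rgg_space n). \<forall>i\<in>{..<n}. \<forall>j\<in>{..<n}.
    (i, j) \<in> G \<longleftrightarrow> dist (x i) (x j) \<le> r}" for G
  define adj where "adj G i j \<longleftrightarrow> i \<noteq> j \<and> (i, j) \<in> G" for G :: "(nat \<times> nat) set" and i j
  have cop: "cop_number {..<n} (rgg_adj x r) = cop_number {..<n} (adj G)" if "x \<in> A G" for x G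
  proof -
    have "cops_win {..<n} (rgg_adj x r) k = cops_win {..<n} (adj G) k" for k
      by (rule cops_win_cong) (use that in \<open>auto simp: A_def adj_def rgg_adj_def\<close>)
    then show ?thesis by (simp add: cop_number_def)
  qed
  have "{x \<in> space (rgg_space n). cop_number {..<n} (rgg_adj x r) > 1} =
    (\<Union>G\<in>{G \<in> Pow V. cop_number {..<n} (adj G) > 1}. A G)" (is "?L = ?R")
  proof
    show "?R \<subseteq> ?L" using cop by (auto simp: A_def)
    show "?L \<subseteq> ?R"
    proof
      fix x assume x: "x \<in> ?L"
      define G where "G = {(i, j) \<in> V. dist (x i) (x j) \<le> r}"
      have "x \<in> A G" using x by (auto simp: A_def G_def V_def)
      moreover have "G \<in> Pow V" by (auto simp: G_def)
      ultimately show "x \<in> ?R" using cop x by auto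
    qed
  qed
  moreover have "A G \<in> sets (rgg_space n)" for G
  proof -
    have [measurable]: "(\<lambda>x. x i) \<in> borel_measurable (rgg_space n)" if "i < n" for i
      using measurable_component_singleton[of i "{..<n}" "\<lambda>_. uniform_measure lborel unit_square"] that
      by (simp add: rgg_space_def cong: measurable_cong_sets)
    show ?thesis unfolding A_def by measurable
  qed
  moreover have "finite {G \<in> Pow V. cop_number {..<n} (adj G) > 1}"
    by (simp add: V_def)
  ultimately show ?thesis by auto
qed

section \<open>Occurrence of local patterns\<close>

text \<open>Chebyshev's inequality for the number \<open>?N\<close> of events that occur: where none
  occurs, (?N - S)^2 equals S^2. Its expectation is at most S + (\<kappa> - 1) S^2, and
  \<open>\<kappa>\<close> close to 1 expresses approximate pairwise independence.\<close>

lemma (in prob_space) second_moment_bound: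
  fixes \<kappa> :: real
  assumes "finite I" and ev: "\<And>b. b \<in> I \<Longrightarrow> A b \<in> events"
    and "\<kappa> \<ge> 0"
    and corr: "\<And>b b'. \<lbrakk>b \<in> I; b' \<in> I; b \<noteq> b'\<rbrakk> \<Longrightarrow> prob (A b \<inter> A b') \<le> \<kappa> * (prob (A b) * prob (A b'))"
    and S: "S = (\<Sum>b\<in>I. prob (A b))" "S > 0"
  shows "prob (space M - (\<Union>b\<in>I. A b)) \<le> 1 / S + (\<kappa> - 1)"
proof -
  let ?N = "\<lambda>x. (\<Sum>b\<in>I. indicator (A b) x :: real)"
  let ?U = "space M - (\<Union>b\<in>I. A b)"
  have [measurable]: "?U \<in> events" using ev \<open>finite I\<close> by auto
  have int: "integrable M (indicator B :: 'a \<Rightarrow> real)" if "B \<in> events" for B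
    using that by (simp add: integrable_indicator_iff emeasure_eq_measure)
  have expand: "(?N x - S)\<^sup>2 = (\<Sum>b\<in>I. \<Sum>b'\<in>I. indicator (A b \<inter> A b') x) - 2 * S * ?N x + S\<^sup>2" for x
    by (simp add: power2_diff power2_eq_square[of "?N x"] sum_product indicator_inter_arith algebra_simps)
  have intf: "integrable M (\<lambda>x. (?N x - S)\<^sup>2)"
    unfolding expand using ev int by (intro Bochner_Integration.integrable_add
      Bochner_Integration.integrable_diff integrable_mult_right Bochner_Integration.integrable_sum) auto
  have "S\<^sup>2 * prob ?U = expectation (\<lambda>x. S\<^sup>2 * indicator ?U x)"
    by simp
  also have "\<dots> \<le> expectation (\<lambda>x. (?N x - S)\<^sup>2)"
  proof (rule integral_mono[OF _ intf])
    show "integrable M (\<lambda>x. S\<^sup>2 * indicator ?U x)"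
      by (intro integrable_mult_right int) auto
    fix x
    show "S\<^sup>2 * indicator ?U x \<le> (?N x - S)\<^sup>2"
    proof (cases "x \<in> ?U")
      case True
      then have "?N x = 0" by (intro sum.neutral) (auto simp: indicator_def)
      then show ?thesis by (simp add: indicator_def)
    qed (simp add: indicator_def)
  qed
  also have "\<dots> = (\<Sum>b\<in>I. \<Sum>b'\<in>I. prob (A b \<inter> A b')) - 2 * S * S + S\<^sup>2"
  proof -
    have "expectation (\<lambda>x. (\<Sum>b\<in>I. \<Sum>b'\<in>I. indicator (A b \<inter> A b') x) :: real)
      = (\<Sum>b\<in>I. \<Sum>b'\<in>I. prob (A b \<inter> A b'))"
      using ev int by (subst Bochner_Integration.integral_sum; simp add: Int_absorb2 sets.sets_into_space)+
    moreover have "expectation ?N = S"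
      using ev int unfolding S by (subst Bochner_Integration.integral_sum) (auto simp: Int_absorb2 sets.sets_into_space)
    ultimately show ?thesis
      unfolding expand using ev int
      by (subst Bochner_Integration.integral_add Bochner_Integration.integral_diff;
          (intro Bochner_Integration.integrable_diff integrable_mult_right Bochner_Integration.integrable_sum)?; auto simp: prob_space)+
  qed
  also have "(\<Sum>b\<in>I. \<Sum>b'\<in>I. prob (A b \<inter> A b')) \<le> S + \<kappa> * S\<^sup>2"
  proof -
    have "(\<Sum>b'\<in>I. prob (A b \<inter> A b')) \<le> prob (A b) + \<kappa> * prob (A b) * S" if "b \<in> I" for b
    proof -
      \<comment> \<open>The diagonal term is bounded separately; adding the correlation term there
        as well is harmless because \<kappa> \<ge> 0, and it completes the sum to
        \<open>S\<close>.\<close>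
      have "(\<Sum>b'\<in>I. prob (A b \<inter> A b')) \<le>
          (\<Sum>b'\<in>I. (if b' = b then prob (A b) else 0) + \<kappa> * (prob (A b) * prob (A b')))"
        using that corr \<open>\<kappa> \<ge> 0\<close> by (intro sum_mono) auto
      also have "\<dots> = prob (A b) + \<kappa> * prob (A b) * S"
        using that \<open>finite I\<close> by (simp add: sum.distrib S sum_distrib_left mult.assoc)
      finally show ?thesis .
    qed
    then have "(\<Sum>b\<in>I. \<Sum>b'\<in>I. prob (A b \<inter> A b')) \<le> (\<Sum>b\<in>I. prob (A b) + \<kappa> * prob (A b) * S)"
      by (rule sum_mono)
    also have "\<dots> = S + \<kappa> * S\<^sup>2"
      by (simp add: sum.distrib S(1)[symmetric] power2_eq_square mult.assoc
          flip: sum_distrib_left sum_distrib_right)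
    finally show ?thesis .
  qed
  finally have "S\<^sup>2 * prob ?U \<le> S + \<kappa> * S\<^sup>2 - S\<^sup>2"
    by (simp add: power2_eq_square)
  then have "prob ?U \<le> (S + \<kappa> * S\<^sup>2 - S\<^sup>2) / S\<^sup>2"
    using \<open>S > 0\<close> by (simp add: pos_le_divide_eq mult.commute)
  also have "\<dots> = 1 / S + (\<kappa> - 1)"
    using \<open>S > 0\<close> by (simp add: field_simps power2_eq_square)
  finally show ?thesis .
qed

section \<open>Patterns and their placements\<close>

text \<open>If the members of \<open>Ps\<close> are disjoint subsets of \<open>Q\<close>, this says that each of them contains exactly
  one of the \<open>n\<close> points, namely \<open>xs\<close> in this order, and that the rest of \<open>Q\<close> contains none.\<close>
definition pattern_at :: "nat \<Rightarrow> 'a set list \<Rightarrow> 'a set \<Rightarrow> (nat \<Rightarrow> 'a) \<Rightarrow> nat list \<Rightarrow> bool" where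
  "pattern_at n Ps Q x xs \<longleftrightarrow> distinct xs \<and> set xs \<subseteq> {..<n} \<and>
    list_all2 (\<lambda>i P. x i \<in> P) xs Ps \<and> (\<forall>i<n. i \<notin> set xs \<longrightarrow> x i \<notin> Q)"

definition has_pattern :: "nat \<Rightarrow> 'a set list \<Rightarrow> 'a set \<Rightarrow> (nat \<Rightarrow> 'a) \<Rightarrow> bool" where
  "has_pattern n Ps Q x \<longleftrightarrow> (\<exists>xs. pattern_at n Ps Q x xs)"

text \<open>Lists rather than sets, because the order tells which point goes into which member of
  the pattern; their number is the falling factorial.\<close>

definition placements :: "nat \<Rightarrow> nat \<Rightarrow> nat list set" where
  "placements n m = {xs. length xs = m \<and> distinct xs \<and> set xs \<subseteq> {..<n}}"

lemma finite_placements: "finite (placements n m)"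
  by (rule finite_subset[OF _ finite_lists_length_eq[of "{..<n}" m]]) (auto simp: placements_def)

lemma pattern_at_placements: "pattern_at n Ps Q x xs \<Longrightarrow> xs \<in> placements n (length Ps)"
  by (auto simp: pattern_at_def placements_def dest: list_all2_lengthD)

text \<open>Each factor of the falling factorial is at least n / 2 when 2 m \<le> n.\<close>

lemma card_placements_ge:
  assumes "2 * m \<le> n"
  shows "(real n / 2) ^ m \<le> real (card (placements n m))"
proof -
  have "card (placements n m) = \<Prod>{n - m + 1..n}"
    using card_lists_distinct_length_eq[of "{..<n}" m] assms by (simp add: placements_def)
  then have "real (card (placements n m)) = (\<Prod>i\<in>{n - m + 1..n}. real i)"
    by simp
  also have "\<dots> \<ge> (\<Prod>i\<in>{n - m + 1..n}. real n / 2)"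
    using assms by (intro prod_mono) auto
  also have "(\<Prod>i\<in>{n - m + 1..n}. real n / 2) = (real n / 2) ^ m"
    using assms by simp
  finally show ?thesis .
qed

text \<open>Cutting a list in the middle is injective. This matches the count for a joint pattern
  with the product of the two single counts.\<close>

lemma card_placements_double_le:
  "real (card (placements n (m + m))) \<le> (real (card (placements n m)))\<^sup>2"
proof -
  have "card (placements n (m + m)) \<le> card (placements n m \<times> placements n m)"
  proof (rule card_inj_on_le)
    show "inj_on (\<lambda>xs. (take m xs, drop m xs)) (placements n (m + m))"
      by (rule inj_onI) (metis append_take_drop_id prod.inject)
    show "(\<lambda>xs. (take m xs, drop m xs)) ` placements n (m + m) \<subseteq> placements n m \<times> placements n m"
      by (auto simp: placements_def dest: in_set_takeD in_set_dropD)
  qed (simp add: finite_placements)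
  then show ?thesis
    by (simp add: power2_eq_square card_cartesian_product flip: of_nat_mult)
qed

text \<open>Turns the joint occurrence of two patterns into a single pattern, so that one
  probability formula covers pairs too. Disjoint regions force disjoint index lists.\<close>

lemma has_pattern_append:
  assumes "has_pattern n Ps Q x" "has_pattern n Ps' Q' x" "Q \<inter> Q' = {}"
    and "\<And>P. P \<in> set Ps \<Longrightarrow> P \<subseteq> Q" "\<And>P. P \<in> set Ps' \<Longrightarrow> P \<subseteq> Q'"
  shows "has_pattern n (Ps @ Ps') (Q \<union> Q') x"
proof -
  from assms(1,2) obtain xs ys where xs: "pattern_at n Ps Q x xs" and ys: "pattern_at n Ps' Q' x ys"
    by (auto simp: has_pattern_def)
  have "x i \<in> Q" if "i \<in> set xs" for i
    using xs that assms(4) by (fastforce simp: pattern_at_def list_all2_conv_all_nth in_set_conv_nth)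
  moreover have "x i \<in> Q'" if "i \<in> set ys" for i
    using ys that assms(5) by (fastforce simp: pattern_at_def list_all2_conv_all_nth in_set_conv_nth)
  ultimately have "pattern_at n (Ps @ Ps') (Q \<union> Q') x (xs @ ys)"
    using xs ys \<open>Q \<inter> Q' = {}\<close> by (auto simp: pattern_at_def intro!: list_all2_appendI)
  then show ?thesis by (auto simp: has_pattern_def)
qed

text \<open>The point with index \<open>xs ! j\<close> lies in \<open>Q\<close>, so this index must
  occur in \<open>ys\<close>, and disjointness of \<open>Ps\<close> fixes its position. Thus the
  events of different placements exclude each other and their probabilities add up exactly.\<close>

lemma pattern_at_unique:
  assumes "pattern_at n Ps Q x xs" "pattern_at n Ps Q x ys"
    and sub: "\<And>P. P \<in> set Ps \<Longrightarrow> P \<subseteq> Q"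
    and disj: "\<And>j k. \<lbrakk>j < length Ps; k < length Ps; j \<noteq> k\<rbrakk> \<Longrightarrow> Ps ! j \<inter> Ps ! k = {}"
  shows "xs = ys"
proof (rule nth_equalityI)
  have len: "length xs = length Ps" "length ys = length Ps"
    using assms(1,2) by (auto simp: pattern_at_def dest: list_all2_lengthD)
  then show "length xs = length ys" by simp
  fix j assume j: "j < length xs"
  have xj: "x (xs ! j) \<in> Ps ! j"
    using assms(1) j by (auto simp: pattern_at_def list_all2_conv_all_nth)
  have xjn: "xs ! j < n"
    using assms(1) nth_mem[OF j] unfolding pattern_at_def by blast
  have "x (xs ! j) \<in> Q" using sub[of "Ps ! j"] j len xj by auto
  then have "xs ! j \<in> set ys" using assms(2) xjn by (auto simp: pattern_at_def)
  then obtain k where k: "k < length ys" "ys ! k = xs ! j" by (auto simp: in_set_conv_nth)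
  then have "x (xs ! j) \<in> Ps ! k"
    using assms(2) by (auto simp: pattern_at_def list_all2_conv_all_nth)
  then have "k = j" using disj[of j k] xj j k len by auto
  then show "xs ! j = ys ! j" using k by simp
qed

section \<open>Probability of a pattern among independent points\<close>

context
  fixes M :: "'a measure" and n :: nat
  assumes M: "prob_space M"
begin

abbreviation (input) "\<Omega> \<equiv> PiM {..<n} (\<lambda>_. M)"

lemma prob_space_Omega: "prob_space \<Omega>"
  by (intro prob_space_PiM M)

text \<open>For a fixed placement the event is a product set: each listed index is confined to its
  member of \<open>Ps\<close>, every other index to the complement of \<open>Q\<close>.\<close>

lemma pattern_at_event:
  assumes xs: "xs \<in> placements n (length Ps)"
    and Ps: "\<And>P. P \<in> set Ps \<Longrightarrow> P \<in> sets M" "\<And>P. P \<in> set Ps \<Longrightarrow> measure M P = a"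
    and Q: "Q \<in> sets M"
  shows "{x \<in> space \<Omega>. pattern_at n Ps Q x xs} \<in> sets \<Omega>"
    and "measure \<Omega> {x \<in> space \<Omega>. pattern_at n Ps Q x xs} =
      a ^ length Ps * (1 - measure M Q) ^ (n - length Ps)"
proof -
  interpret M: prob_space M by (rule M)
  interpret P: finite_product_prob_space "\<lambda>_. M" "{..<n}" by standard auto
  define X where "X i = (case map_of (zip xs Ps) i of Some P \<Rightarrow> P | None \<Rightarrow> space M - Q)" for i
  have xs': "length xs = length Ps" "distinct xs" "set xs \<subseteq> {..<n}"
    using xs by (auto simp: placements_def)
  have X_nth: "X (xs ! j) = Ps ! j" if "j < length Ps" for j
    using that xs' by (simp add: X_def map_of_zip_nth)
  have X_other: "X i = space M - Q" if "i \<notin> set xs" for i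
  proof -
    have "map_of (zip xs Ps) i = None" using that xs' by (simp add: map_of_zip_is_None)
    then show ?thesis by (simp add: X_def)
  qed
  have X_cases: "(\<exists>j<length Ps. i = xs ! j \<and> X i = Ps ! j) \<or> i \<notin> set xs \<and> X i = space M - Q" for i
    using X_nth X_other xs'(1) by (metis in_set_conv_nth)
  have X_sets: "X i \<in> sets M" for i
    using X_cases[of i] Ps(1) Q by auto
  have eq: "{x \<in> space \<Omega>. pattern_at n Ps Q x xs} = Pi\<^sub>E {..<n} X"
  proof (intro equalityI subsetI)
    fix x assume x: "x \<in> {x \<in> space \<Omega>. pattern_at n Ps Q x xs}"
    then have xs_in: "\<And>j. j < length Ps \<Longrightarrow> x (xs ! j) \<in> Ps ! j"
      by (auto simp: pattern_at_def list_all2_conv_all_nth)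
    have "x i \<in> X i" if "i < n" for i
      using X_cases[of i] xs_in x that by (auto simp: pattern_at_def space_PiM)
    then show "x \<in> Pi\<^sub>E {..<n} X" using x by (auto simp: space_PiM PiE_iff)
  next
    fix x assume x: "x \<in> Pi\<^sub>E {..<n} X"
    then have xX: "x i \<in> X i" if "i < n" for i using that by auto
    have "x \<in> space \<Omega>"
      using x xX sets.sets_into_space[OF X_sets] by (auto simp: space_PiM PiE_iff)
    moreover have "x (xs ! j) \<in> Ps ! j" if "j < length Ps" for j
    proof -
      have "xs ! j \<in> set xs" using that xs' by simp
      then have "xs ! j < n" using xs'(3) by blast
      then show ?thesis using xX[of "xs ! j"] X_nth that by simp
    qed
    moreover have "x i \<notin> Q" if "i < n" "i \<notin> set xs" for i
      using xX[OF that(1)] X_other[OF that(2)] by simp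
    ultimately show "x \<in> {x \<in> space \<Omega>. pattern_at n Ps Q x xs}"
      using xs' by (auto simp: pattern_at_def list_all2_conv_all_nth)
  qed
  show "{x \<in> space \<Omega>. pattern_at n Ps Q x xs} \<in> sets \<Omega>"
    unfolding eq by (rule sets_PiM_I_finite) (auto simp: X_sets)
  have "measure \<Omega> (Pi\<^sub>E {..<n} X) = (\<Prod>i<n. measure M (X i))"
    by (rule P.finite_measure_PiM_emb) (simp add: X_sets)
  also have "\<dots> = (\<Prod>i<n. if i \<in> set xs then a else 1 - measure M Q)"
  proof (rule prod.cong[OF refl])
    fix i
    show "measure M (X i) = (if i \<in> set xs then a else 1 - measure M Q)"
      using X_cases[of i] Ps(2) Q xs'(1) by (auto simp: M.prob_compl)
  qed
  also have "\<dots> = a ^ card ({..<n} \<inter> set xs) * (1 - measure M Q) ^ card ({..<n} \<inter> - set xs)"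
    by (simp add: prod.If_cases Collect_mem_eq Collect_neg_eq)
  also have "{..<n} \<inter> set xs = set xs" using xs' by auto
  also have "card (set xs) = length Ps" using xs' by (simp add: distinct_card)
  also have "card ({..<n} \<inter> - set xs) = n - length Ps"
    using xs' by (simp add: Diff_eq[symmetric] card_Diff_subset distinct_card)
  finally show "measure \<Omega> {x \<in> space \<Omega>. pattern_at n Ps Q x xs} =
      a ^ length Ps * (1 - measure M Q) ^ (n - length Ps)"
    by (simp add: eq)
qed

lemma has_pattern_UN:
  "{x \<in> space \<Omega>. has_pattern n Ps Q x} =
    (\<Union>xs\<in>placements n (length Ps). {x \<in> space \<Omega>. pattern_at n Ps Q x xs})"
  using pattern_at_placements by (fastforce simp: has_pattern_def)

text \<open>The upper bound is subadditivity over placements and serves concatenated patterns; the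
  equality rests on uniqueness of the placement and serves single ones.\<close>

lemma has_pattern_event:
  assumes Ps: "\<And>P. P \<in> set Ps \<Longrightarrow> P \<in> sets M" "\<And>P. P \<in> set Ps \<Longrightarrow> measure M P = a"
    and Q: "Q \<in> sets M"
  shows "{x \<in> space \<Omega>. has_pattern n Ps Q x} \<in> sets \<Omega>" (is ?ev)
    and "measure \<Omega> {x \<in> space \<Omega>. has_pattern n Ps Q x} \<le>
      real (card (placements n (length Ps))) * (a ^ length Ps * (1 - measure M Q) ^ (n - length Ps))"
        (is ?le)
    and "(\<And>P. P \<in> set Ps \<Longrightarrow> P \<subseteq> Q) \<Longrightarrow>
      (\<And>j k. \<lbrakk>j < length Ps; k < length Ps; j \<noteq> k\<rbrakk> \<Longrightarrow> Ps ! j \<inter> Ps ! k = {}) \<Longrightarrow>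
      measure \<Omega> {x \<in> space \<Omega>. has_pattern n Ps Q x} =
      real (card (placements n (length Ps))) * (a ^ length Ps * (1 - measure M Q) ^ (n - length Ps))"
        (is "PROP ?eq")
proof -
  interpret P: prob_space \<Omega> by (rule prob_space_Omega)
  note ev = pattern_at_event[OF _ Ps Q]
  show ?ev unfolding has_pattern_UN using ev(1) finite_placements by auto
  have "measure \<Omega> {x \<in> space \<Omega>. has_pattern n Ps Q x} \<le>
    (\<Sum>xs\<in>placements n (length Ps). measure \<Omega> {x \<in> space \<Omega>. pattern_at n Ps Q x xs})"
    unfolding has_pattern_UN by (intro measure_UNION_le) (use ev(1) finite_placements in auto)
  then show ?le by (simp add: ev(2))
  show "PROP ?eq"
  proof -
    assume sub: "\<And>P. P \<in> set Ps \<Longrightarrow> P \<subseteq> Q"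
      and disj: "\<And>j k. \<lbrakk>j < length Ps; k < length Ps; j \<noteq> k\<rbrakk> \<Longrightarrow> Ps ! j \<inter> Ps ! k = {}"
    have "disjoint_family_on (\<lambda>xs. {x \<in> space \<Omega>. pattern_at n Ps Q x xs}) (placements n (length Ps))"
      using pattern_at_unique[OF _ _ sub disj] by (fastforce simp: disjoint_family_on_def)
    then have "measure \<Omega> {x \<in> space \<Omega>. has_pattern n Ps Q x} =
      (\<Sum>xs\<in>placements n (length Ps). measure \<Omega> {x \<in> space \<Omega>. pattern_at n Ps Q x xs})"
      unfolding has_pattern_UN
      by (intro P.finite_measure_finite_Union) (use ev(1) finite_placements in auto)
    then show "measure \<Omega> {x \<in> space \<Omega>. has_pattern n Ps Q x} =
      real (card (placements n (length Ps))) * (a ^ length Ps * (1 - measure M Q) ^ (n - length Ps))"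
      by (simp add: ev(2))
  qed
qed

end

text \<open>The second moment bound with \<open>\<kappa>\<close> = 1 / (1 - 2 m q). The term
  \<open>L\<close> bounds each single probability from below: the falling factorial is at least (n /
  2)^m, and the at most \<open>n\<close> remaining points avoid a region of area at most
  \<open>q\<close>.\<close>

lemma no_pattern_bound:
  fixes M :: "'a measure" and q a :: real
  assumes M: "prob_space M" and I: "finite I" "I \<noteq> {}"
    and len: "\<And>b. b \<in> I \<Longrightarrow> length (Ps b) = m"
    and Ps: "\<And>b P. b \<in> I \<Longrightarrow> P \<in> set (Ps b) \<Longrightarrow> P \<in> sets M"
      "\<And>b P. b \<in> I \<Longrightarrow> P \<in> set (Ps b) \<Longrightarrow> measure M P = a"
      "\<And>b P. b \<in> I \<Longrightarrow> P \<in> set (Ps b) \<Longrightarrow> P \<subseteq> Q b"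
    and disj: "\<And>b j k. \<lbrakk>b \<in> I; j < m; k < m; j \<noteq> k\<rbrakk> \<Longrightarrow> Ps b ! j \<inter> Ps b ! k = {}"
    and Q: "\<And>b. b \<in> I \<Longrightarrow> Q b \<in> sets M" "\<And>b. b \<in> I \<Longrightarrow> measure M (Q b) \<le> q"
      "\<And>b b'. \<lbrakk>b \<in> I; b' \<in> I; b \<noteq> b'\<rbrakk> \<Longrightarrow> Q b \<inter> Q b' = {}"
    and mn: "2 * m \<le> n" "n > 0" and "a > 0" and q: "0 \<le> q" "q < 1" "2 * real m * q < 1"
  shows "measure (PiM {..<n} (\<lambda>_. M))
      {x \<in> space (PiM {..<n} (\<lambda>_. M)). \<forall>b\<in>I. \<not> has_pattern n (Ps b) (Q b) x} \<le>
    1 / (real (card I) * ((real n * a / 2) ^ m * (1 - q) ^ n)) + (1 / (1 - 2 * real m * q) - 1)"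
proof -
  let ?\<Omega> = "PiM {..<n} (\<lambda>_. M)"
  define A where "A b = {x \<in> space ?\<Omega>. has_pattern n (Ps b) (Q b) x}" for b
  define N where "N = real (card (placements n m))"
  define \<kappa> where "\<kappa> = 1 / (1 - 2 * real m * q)"
  define L where "L = (real n * a / 2) ^ m * (1 - q) ^ n"
  interpret M: prob_space M by (rule M)
  interpret P: prob_space ?\<Omega> by (rule prob_space_Omega[OF M])
  have ev: "A b \<in> sets ?\<Omega>" if "b \<in> I" for b
    unfolding A_def by (rule has_pattern_event[OF M Ps(1,2) Q(1)]) (use that in auto)
  have prob_A: "P.prob (A b) = N * (a ^ m * (1 - measure M (Q b)) ^ (n - m))" if "b \<in> I" for b
  proof -
    have "P.prob (A b) = real (card (placements n (length (Ps b)))) *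
        (a ^ length (Ps b) * (1 - measure M (Q b)) ^ (n - length (Ps b)))"
      unfolding A_def
      by (rule has_pattern_event(3)[OF M Ps(1,2) Q(1) Ps(3)])
        (use that disj len[OF that] in auto)
    then show ?thesis using len[OF that] by (simp add: N_def)
  qed
  have "L > 0" using mn \<open>a > 0\<close> q by (simp add: L_def)
  have "L \<le> P.prob (A b)" if "b \<in> I" for b
  proof -
    have "(real n / 2) ^ m * (a ^ m * (1 - q) ^ n) \<le> N * (a ^ m * (1 - measure M (Q b)) ^ (n - m))"
    proof (intro mult_mono order.refl)
      show "(real n / 2) ^ m \<le> N" unfolding N_def by (rule card_placements_ge[OF mn(1)])
      have "(1 - q) ^ n \<le> (1 - q) ^ (n - m)" using q by (intro power_decreasing) auto
      also have "\<dots> \<le> (1 - measure M (Q b)) ^ (n - m)"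
        using q Q(2)[OF that] by (intro power_mono) auto
      finally show "(1 - q) ^ n \<le> (1 - measure M (Q b)) ^ (n - m)" .
    qed (use \<open>a > 0\<close> q in \<open>auto simp: N_def\<close>)
    moreover have "L = (real n / 2) ^ m * (a ^ m * (1 - q) ^ n)"
      unfolding L_def by (simp add: power_mult_distrib power_divide)
    ultimately show ?thesis using prob_A[OF that] by simp
  qed
  then have S: "real (card I) * L \<le> (\<Sum>b\<in>I. P.prob (A b))"
    by (intro sum_bounded_below)
  have "real (card I) * L > 0" using I \<open>L > 0\<close> by (simp add: card_gt_0_iff)
  have "\<kappa> \<ge> 0" using q by (simp add: \<kappa>_def)
  have corr: "P.prob (A b \<inter> A b') \<le> \<kappa> * (P.prob (A b) * P.prob (A b'))"
    if b: "b \<in> I" "b' \<in> I" "b \<noteq> b'" for b b'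
  proof -
    define p p' where "p = measure M (Q b)" and "p' = measure M (Q b')"
    have p: "0 \<le> p" "p \<le> q" "0 \<le> p'" "p' \<le> q" using Q(2) b by (auto simp: p_def p'_def)
    \<comment> \<open>A joint pattern leaves n - 2 m points free, whereas each single probability
      carries the exponent n - m. So the ratio of the joint probability to the product is at most
      u^(-m), and Bernoulli's inequality gives u^m \<ge> (1 - q)^(2 m) \<ge> 1 - 2 m q.\<close>
    define u where "u = (1 - p) * (1 - p')"
    have pp': "measure M (Q b \<union> Q b') = p + p'"
      using Q b unfolding p_def p'_def by (intro M.finite_measure_Union) auto
    then have "p + p' \<le> 1" using M.prob_le_1[of "Q b \<union> Q b'"] by simp
    have u: "1 - (p + p') \<le> u" using p by (simp add: u_def algebra_simps)
    have "u \<ge> (1 - q) * (1 - q)"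
      unfolding u_def using p q by (intro mult_mono) auto
    then have "u ^ m \<ge> ((1 - q) * (1 - q)) ^ m"
      using q by (intro power_mono) auto
    also have "((1 - q) * (1 - q)) ^ m = (1 - q) ^ (2 * m)"
      by (simp add: power_mult_distrib mult_2 power_add)
    also have "\<dots> \<ge> 1 - 2 * real m * q"
      using Bernoulli_inequality[of "- q" "2 * m"] q by simp
    finally have um: "1 - 2 * real m * q \<le> u ^ m" .
    have "u \<ge> 0" using p q by (simp add: u_def)
    have "u ^ (n - 2 * m) = \<kappa> * (u ^ (n - 2 * m) * (1 - 2 * real m * q))"
      using q by (simp add: \<kappa>_def)
    also have "\<dots> \<le> \<kappa> * (u ^ (n - 2 * m) * u ^ m)"
      using um \<open>u \<ge> 0\<close> \<open>\<kappa> \<ge> 0\<close> by (intro mult_left_mono) auto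
    also have "u ^ (n - 2 * m) * u ^ m = u ^ (n - m)"
      using mn by (simp flip: power_add)
    finally have un: "u ^ (n - 2 * m) \<le> \<kappa> * u ^ (n - m)" .
    have "P.prob (A b \<inter> A b') \<le>
        P.prob {x \<in> space ?\<Omega>. has_pattern n (Ps b @ Ps b') (Q b \<union> Q b') x}"
    proof (rule P.finite_measure_mono)
      show "A b \<inter> A b' \<subseteq> {x \<in> space ?\<Omega>. has_pattern n (Ps b @ Ps b') (Q b \<union> Q b') x}"
        unfolding A_def using has_pattern_append[OF _ _ Q(3)[OF b] Ps(3)[OF b(1)] Ps(3)[OF b(2)]]
        by auto
      show "{x \<in> space ?\<Omega>. has_pattern n (Ps b @ Ps b') (Q b \<union> Q b') x} \<in> P.events"
        by (rule has_pattern_event(1)[OF M, where a = a]) (use Ps Q b in auto)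
    qed
    also have "\<dots> \<le> real (card (placements n (length (Ps b @ Ps b')))) *
        (a ^ length (Ps b @ Ps b') *
          (1 - measure M (Q b \<union> Q b')) ^ (n - length (Ps b @ Ps b')))"
      by (rule has_pattern_event(2)[OF M]) (use Ps Q b in auto)
    also have "\<dots> = real (card (placements n (m + m))) * (a ^ (2 * m) * (1 - (p + p')) ^ (n - 2 * m))"
      using len b pp' by (simp add: mult_2)
    also have "\<dots> \<le> N\<^sup>2 * (a ^ (2 * m) * (\<kappa> * u ^ (n - m)))"
    proof (intro mult_mono order.refl)
      show "real (card (placements n (m + m))) \<le> N\<^sup>2"
        unfolding N_def by (rule card_placements_double_le)
      have "(1 - (p + p')) ^ (n - 2 * m) \<le> u ^ (n - 2 * m)"
        using u \<open>p + p' \<le> 1\<close> by (intro power_mono) auto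
      with un show "(1 - (p + p')) ^ (n - 2 * m) \<le> \<kappa> * u ^ (n - m)" by simp
    qed (use \<open>a > 0\<close> \<open>p + p' \<le> 1\<close> in auto)
    also have "\<dots> = \<kappa> * (P.prob (A b) * P.prob (A b'))"
      using b by (simp add: prob_A u_def p_def p'_def power_mult_distrib power2_eq_square
          power_mult mult_ac)
    finally show ?thesis .
  qed
  have "{x \<in> space ?\<Omega>. \<forall>b\<in>I. \<not> has_pattern n (Ps b) (Q b) x} = space ?\<Omega> - (\<Union>b\<in>I. A b)"
    by (auto simp: A_def)
  then have "P.prob {x \<in> space ?\<Omega>. \<forall>b\<in>I. \<not> has_pattern n (Ps b) (Q b) x} \<le>
      1 / (\<Sum>b\<in>I. P.prob (A b)) + (\<kappa> - 1)"
    using P.second_moment_bound[OF I(1) ev \<open>\<kappa> \<ge> 0\<close> corr refl] S \<open>real (card I) * L > 0\<close> by simp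
  also have "\<dots> \<le> 1 / (real (card I) * L) + (\<kappa> - 1)"
    using S \<open>real (card I) * L > 0\<close> by (intro add_right_mono frac_le) auto
  finally show ?thesis by (simp add: L_def \<kappa>_def)
qed

text \<open>Interface for both constructions. A pattern is a template that can be moved to any
  centre \<open>t\<close> and lies in an open box of half side \<open>B\<close> around it; areas are
  Lebesgue areas, so a construction need not refer to the unit square. The template is copied into a
  \<open>g\<close> by \<open>g\<close> grid of boxes.\<close>

lemma rgg_cop_number_gt_1_bound:
  fixes B a q r :: real
  assumes g: "g > 0" "2 * B * real g \<le> 1" and "B > 0"
    and len: "\<And>t. length (Ps t) = m"
    and Ps: "\<And>t P. P \<in> set (Ps t) \<Longrightarrow> P \<in> sets borel"
      "\<And>t P. P \<in> set (Ps t) \<Longrightarrow> emeasure lborel P = ennreal a"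
      "\<And>t P. P \<in> set (Ps t) \<Longrightarrow> P \<subseteq> Q t"
    and disj: "\<And>t j k. \<lbrakk>j < m; k < m; j \<noteq> k\<rbrakk> \<Longrightarrow> Ps t ! j \<inter> Ps t ! k = {}"
    and Q: "\<And>t. Q t \<in> sets borel" "\<And>t. emeasure lborel (Q t) \<le> ennreal q"
      "\<And>t v. v \<in> Q t \<Longrightarrow> \<bar>fst v - fst t\<bar> < B \<and> \<bar>snd v - snd t\<bar> < B"
    and escape: "\<And>t x. has_pattern n (Ps t) (Q t) x \<Longrightarrow> \<not> cops_win {..<n} (rgg_adj x r) 1"
    and mn: "2 * m \<le> n" "n > 0" and "a > 0" and q: "0 \<le> q" "q < 1" "2 * real m * q < 1"
  shows "measure (rgg_space n) {x \<in> space (rgg_space n). cop_number {..<n} (rgg_adj x r) > 1} \<ge>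
    1 - (1 / ((real g)\<^sup>2 * ((real n * a / 2) ^ m * (1 - q) ^ n)) + (1 / (1 - 2 * real m * q) - 1))"
proof -
  let ?M = "uniform_measure lborel unit_square"
  define I where "I = {..<g} \<times> {..<g}"
  \<comment> \<open>Centres at odd multiples of \<open>B\<close> make boxes of side 2 B tile a
    square of side 2 B g \<le> 1. The strict bounds on \<open>Q\<close> keep the regions of adjacent
    boxes disjoint.\<close>
  define c :: "nat \<times> nat \<Rightarrow> real \<times> real"
    where "c b = ((2 * real (fst b) + 1) * B, (2 * real (snd b) + 1) * B)" for b
  have M: "prob_space ?M" by (rule prob_space_uniform_unit_square)
  interpret P: prob_space "rgg_space n"
    unfolding rgg_space_def by (rule prob_space_PiM) (rule M)
  have sub1: "0 \<le> y \<and> y \<le> 1" if "i < g" "\<bar>y - (2 * real i + 1) * B\<bar> < B" for i y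
  proof -
    define z where "z = real i * B"
    have "z \<ge> 0" using \<open>B > 0\<close> by (simp add: z_def)
    moreover have "(2 * real i + 2) * B \<le> 2 * real g * B"
      using that(1) \<open>B > 0\<close> by (intro mult_right_mono) auto
    then have "2 * z + 2 * B \<le> 1" using g(2) by (simp add: z_def algebra_simps)
    moreover have "\<bar>y - (2 * z + B)\<bar> < B" using that(2) by (simp add: z_def algebra_simps)
    ultimately show ?thesis by linarith
  qed
  have sub: "Q (c b) \<subseteq> unit_square" if "b \<in> I" for b
  proof
    fix v assume "v \<in> Q (c b)"
    from Q(3)[OF this] sub1 that show "v \<in> unit_square"
      by (cases v) (auto simp: unit_square_def I_def c_def)
  qed
  have meas: "measure ?M A = measure lborel A" if "A \<in> sets borel" "A \<subseteq> unit_square" for A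
  proof -
    have "measure ?M A = measure lborel (unit_square \<inter> A) / measure lborel unit_square"
      using that emeasure_unit_square by (intro measure_uniform_measure) auto
    then show ?thesis
      using that emeasure_unit_square by (simp add: Int_absorb1 measure_def)
  qed
  have sep1: "i = i'" if "\<bar>y - (2 * real i + 1) * B\<bar> < B" "\<bar>y - (2 * real i' + 1) * B\<bar> < B"
    for i i' :: nat and y
  proof -
    have "\<bar>(2 * real i + 1) * B - (2 * real i' + 1) * B\<bar> < 2 * B" using that by linarith
    moreover have "(2 * real i + 1) * B - (2 * real i' + 1) * B = (2 * (real i - real i')) * B"
      by (simp add: algebra_simps)
    ultimately have "\<bar>real i - real i'\<bar> < 1" using \<open>B > 0\<close> by (simp add: abs_mult)
    then show ?thesis by linarith
  qed
  have "measure (rgg_space n)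
      {x \<in> space (rgg_space n). \<forall>b\<in>I. \<not> has_pattern n (Ps (c b)) (Q (c b)) x} \<le>
    1 / (real (card I) * ((real n * a / 2) ^ m * (1 - q) ^ n)) + (1 / (1 - 2 * real m * q) - 1)"
    unfolding rgg_space_def
  proof (rule no_pattern_bound[OF M _ _ len _ _ Ps(3)])
    show "finite I" "I \<noteq> {}" using g(1) by (auto simp: I_def)
    show "Q (c b) \<inter> Q (c b') = {}" if "b \<noteq> b'" for b b'
    proof (rule ccontr)
      assume "Q (c b) \<inter> Q (c b') \<noteq> {}"
      then obtain v where "v \<in> Q (c b)" "v \<in> Q (c b')" by blast
      from Q(3)[OF this(1)] Q(3)[OF this(2)] have "b = b'"
        unfolding c_def by (intro prod_eqI) (auto intro: sep1)
      with that show False by simp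
    qed
    show "measure ?M P = a" if "b \<in> I" "P \<in> set (Ps (c b))" for b P
    proof -
      have "P \<subseteq> unit_square" using sub[OF that(1)] Ps(3)[OF that(2)] by blast
      then show ?thesis
        using meas[OF Ps(1)[OF that(2)]] Ps(2)[OF that(2)] \<open>a > 0\<close> by (simp add: measure_def)
    qed
    show "measure ?M (Q (c b)) \<le> q" if "b \<in> I" for b
      using meas[OF Q(1) sub[OF that]] Q(2)[of "c b"] q(1) by (simp add: measure_def enn2real_leI)
  qed (use Ps Q disj mn \<open>a > 0\<close> q in auto)
  moreover have "card I = g\<^sup>2" by (simp add: I_def power2_eq_square)
  moreover have "1 - measure (rgg_space n) {x \<in> space (rgg_space n). cop_number {..<n} (rgg_adj x r) > 1}
     \<le> measure (rgg_space n)
      {x \<in> space (rgg_space n). \<forall>b\<in>I. \<not> has_pattern n (Ps (c b)) (Q (c b)) x}"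
  proof -
    have "space (rgg_space n) - {x \<in> space (rgg_space n). cop_number {..<n} (rgg_adj x r) > 1} \<subseteq>
       {x \<in> space (rgg_space n). \<forall>b\<in>I. \<not> has_pattern n (Ps (c b)) (Q (c b)) x}"
      using escape cop_number_gt_1I[OF \<open>n > 0\<close>] by blast
    moreover have "{x \<in> space (rgg_space n). \<forall>b\<in>I. \<not> has_pattern n (Ps (c b)) (Q (c b)) x} \<in> P.events"
    proof -
      have "{x \<in> space (rgg_space n). has_pattern n (Ps (c b)) (Q (c b)) x} \<in> P.events" if "b \<in> I" for b
        unfolding rgg_space_def
      proof (rule has_pattern_event(1)[OF M])
        show "measure ?M P = a" if "P \<in> set (Ps (c b))" for P
        proof -
          have "P \<subseteq> unit_square" using sub[OF \<open>b \<in> I\<close>] Ps(3)[OF that] by blast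
          then show ?thesis
            using meas[OF Ps(1)[OF that]] Ps(2)[OF that] \<open>a > 0\<close> by (simp add: measure_def)
        qed
      qed (use Ps Q in auto)
      then have "space (rgg_space n) - (\<Union>b\<in>I. {x \<in> space (rgg_space n). has_pattern n (Ps (c b)) (Q (c b)) x})
         \<in> P.events" by (intro sets.Diff sets.finite_UN) (auto simp: I_def)
      then show ?thesis by (rule back_subst[of "\<lambda>A. A \<in> P.events"]) auto
    qed
    ultimately have "P.prob (space (rgg_space n) -
        {x \<in> space (rgg_space n). cop_number {..<n} (rgg_adj x r) > 1}) \<le>
      P.prob {x \<in> space (rgg_space n). \<forall>b\<in>I. \<not> has_pattern n (Ps (c b)) (Q (c b)) x}"
      by (rule P.finite_measure_mono)
    then show ?thesis unfolding P.prob_compl[OF rgg_cop_number_event] .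
  qed
  ultimately show ?thesis by simp
qed

section \<open>A polygon with thin lenses\<close>

lemma cos_ge_1_minus: "cos x \<ge> 1 - x\<^sup>2 / 2" for x :: real
proof -
  have "cos x = 1 - 2 * (sin (x / 2))\<^sup>2" using cos_double_sin[of "x / 2"] by simp
  moreover have "(sin (x / 2))\<^sup>2 \<le> (x / 2)\<^sup>2"
    using abs_sin_x_le_abs_x[of "x / 2"] by (simp only: abs_le_square_iff)
  ultimately show ?thesis by (simp add: power2_eq_square)
qed

text \<open>On [0, 1] the derivative of sin x - x / 2 is nonnegative, because cos \<ge> 1/2
  there.\<close>

lemma sin_ge_half:
  fixes x :: real
  assumes "0 \<le> x" "x \<le> 1"
  shows "x / 2 \<le> sin x"
proof -
  have "\<exists>y. ((\<lambda>x. sin x - x / 2) has_real_derivative y) (at z) \<and> 0 \<le> y" if "0 \<le> z" "z \<le> x" for z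
  proof (intro exI conjI)
    show "((\<lambda>x. sin x - x / 2) has_real_derivative cos z - 1 / 2) (at z)"
      by (auto intro!: derivative_eq_intros)
    have "z\<^sup>2 \<le> 1" using that assms by (simp add: power_le_one)
    then show "0 \<le> cos z - 1 / 2" using cos_ge_1_minus[of z] by simp
  qed
  from DERIV_nonneg_imp_nondecreasing[OF assms(1) this] show ?thesis by simp
qed

lemma dist_Pair_sq: "(dist v w)\<^sup>2 = (fst v - fst w)\<^sup>2 + (snd v - snd w)\<^sup>2"
  for v w :: "real \<times> real"
  by (simp add: dist_prod_def dist_real_def)

lemma mem_sq_of_dist: "dist v c \<le> h \<Longrightarrow> v \<in> sq c h"
  using dist_fst_le[of v c] dist_snd_le[of v c] by (simp add: mem_sq dist_real_def)

lemma dist_of_mem_sq: "v \<in> sq c h \<Longrightarrow> dist v c \<le> 2 * h"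
  using sqrt_sum_squares_le_sum_abs[of "fst v - fst c" "snd v - snd c"]
  by (simp add: mem_sq dist_prod_def dist_real_def)

text \<open>Two discs of radius \<open>R\<close> around (k, -l) and (-k, -l). Each disc limits the
  first coordinate on one side; adding both inequalities cancels the mixed terms and leaves the
  bound on the second coordinate.\<close>

lemma lens_bounds:
  fixes \<alpha> \<beta> k l R :: real
  assumes "(\<alpha> - k)\<^sup>2 + (\<beta> + l)\<^sup>2 \<le> R\<^sup>2" "(\<alpha> + k)\<^sup>2 + (\<beta> + l)\<^sup>2 \<le> R\<^sup>2" "R \<ge> 0"
  shows "\<bar>\<alpha>\<bar> \<le> R - k" "(\<beta> + l)\<^sup>2 \<le> R\<^sup>2 - k\<^sup>2"
proof -
  have "(\<alpha> - k)\<^sup>2 \<le> R\<^sup>2" "(\<alpha> + k)\<^sup>2 \<le> R\<^sup>2"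
    using assms(1,2) zero_le_power2[of "\<beta> + l"] by linarith+
  then have "\<bar>\<alpha> - k\<bar> \<le> R" "\<bar>\<alpha> + k\<bar> \<le> R" using \<open>R \<ge> 0\<close> by (auto simp: power2_le_iff_abs_le)
  then show "\<bar>\<alpha>\<bar> \<le> R - k" by linarith
  have "2 * \<alpha>\<^sup>2 + 2 * k\<^sup>2 + 2 * (\<beta> + l)\<^sup>2 = ((\<alpha> - k)\<^sup>2 + (\<beta> + l)\<^sup>2) + ((\<alpha> + k)\<^sup>2 + (\<beta> + l)\<^sup>2)"
    by (simp add: power2_eq_square algebra_simps)
  also have "\<dots> \<le> 2 * R\<^sup>2" using assms(1,2) by simp
  finally show "(\<beta> + l)\<^sup>2 \<le> R\<^sup>2 - k\<^sup>2" using zero_le_power2[of \<alpha>] by linarith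
qed

section \<open>Geometry of the polygon\<close>

locale rgg_polygon =
  fixes r :: real and m :: nat
  assumes r_pos: "r > 0" and m_ge: "m \<ge> 16"
begin

text \<open>\<open>\<eta>\<close> is the allowed displacement of a point from its corner and also
  the order of the lens width. \<open>\<psi>\<close> is half the central angle of a side,
  \<open>\<l>\<close> the side, which is 2 \<eta> short of \<open>r\<close> so that displaced
  adjacent corners stay within distance \<open>r\<close>, and \<open>\<rho>\<close> the
  circumradius.\<close>

definition \<eta> where "\<eta> = r / (real m)\<^sup>2"
definition \<psi> where "\<psi> = pi / real m"
definition \<l> where "\<l> = r - 2 * \<eta>"
definition \<rho> where "\<rho> = \<l> / (2 * sin \<psi>)"

definition dir :: "nat \<Rightarrow> real \<times> real" where
  "dir i = (cos (2 * \<psi> * real i), sin (2 * \<psi> * real i))"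

definition ctr :: "real \<times> real \<Rightarrow> nat \<Rightarrow> real \<times> real" where
  "ctr t i = t + \<rho> *\<^sub>R dir i"

definition Ps :: "real \<times> real \<Rightarrow> (real \<times> real) set list" where
  "Ps t = map (\<lambda>i. sq (ctr t i) (\<eta> / 2)) [0..<m]"

text \<open>Covers every lens by a row of axis-parallel squares placed at steps of
  \<open>\<eta>\<close> along the radial direction, which avoids areas of rotated regions. The lens
  extends 11 \<eta> tangentially and 9 \<eta> m radially to either side; rounding to the next step
  adds one more \<open>\<eta>\<close> to the half side.\<close>

definition Q :: "real \<times> real \<Rightarrow> (real \<times> real) set" where
  "Q t = (\<Union>i<m. \<Union>k\<in>{- (9 * int m) - 1..9 * int m}.
     sq (ctr t i + (of_int k * \<eta>) *\<^sub>R dir i) (12 * \<eta>))"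

lemma m_real: "real m \<ge> 16" using m_ge by simp

lemma eta_pos: "\<eta> > 0" using r_pos m_ge by (simp add: \<eta>_def)

text \<open>The hierarchy of scales: lens width \<open>\<eta>\<close>, lens length \<eta> m = r / m,
  radius \<open>r\<close>. Consecutive scales differ by a factor of at least 16, which absorbs the
  constants of all later estimates.\<close>

lemma r_ge: "r \<ge> 16 * (\<eta> * real m)" "\<eta> * real m \<ge> 16 * \<eta>"
proof -
  show "\<eta> * real m \<ge> 16 * \<eta>" using eta_pos m_real by simp
  show "r \<ge> 16 * (\<eta> * real m)"
  proof -
    have "\<eta> * real m * real m = r" using m_real by (simp add: \<eta>_def power2_eq_square)
    moreover have "\<eta> * real m * 16 \<le> \<eta> * real m * real m"
      using eta_pos m_real by (intro mult_left_mono) auto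
    ultimately show ?thesis by simp
  qed
qed

lemma l_pos: "\<l> > 0" unfolding \<l>_def using r_ge eta_pos by linarith

lemma psi_bounds: "0 < \<psi>" "\<psi> \<le> 1" "1 / real m \<le> \<psi> / 2" "\<psi> \<le> 4 / real m" "\<psi> \<le> pi / 2"
proof -
  show "0 < \<psi>" "1 / real m \<le> \<psi> / 2" "\<psi> \<le> 4 / real m"
    using m_real pi_gt_zero pi_ge_two pi_less_4 by (auto simp: \<psi>_def field_simps)
  show "\<psi> \<le> 1" using m_real pi_less_4 by (simp add: \<psi>_def field_simps)
  then show "\<psi> \<le> pi / 2" using pi_ge_two by linarith
qed

lemma sin_psi: "sin \<psi> > 0" "1 / real m \<le> sin \<psi>"
proof -
  show "1 / real m \<le> sin \<psi>" using sin_ge_half[of \<psi>] psi_bounds by linarith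
  moreover have "1 / real m > 0" using m_real by simp
  ultimately show "sin \<psi> > 0" by linarith
qed

lemma rho_sin: "2 * \<rho> * sin \<psi> = \<l>" using sin_psi by (simp add: \<rho>_def)

lemma rho_pos: "\<rho> > 0" using l_pos sin_psi by (simp add: \<rho>_def)

lemma rho_le: "\<rho> \<le> r * real m / 2"
proof -
  have "\<rho> \<le> \<l> / (2 * (1 / real m))"
    unfolding \<rho>_def using l_pos sin_psi m_real by (intro divide_left_mono) auto
  also have "\<dots> = \<l> * real m / 2" by simp
  also have "\<dots> \<le> r * real m / 2" using eta_pos by (simp add: \<l>_def mult_right_mono)
  finally show ?thesis .
qed

lemma abs_dir_le: "\<bar>fst (dir i)\<bar> \<le> 1" "\<bar>snd (dir i)\<bar> \<le> 1"
  by (simp_all add: dir_def)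

lemma dir_periodic: "dir (i + m * k) = dir i"
proof -
  have "2 * \<psi> * real (i + m * k) = 2 * \<psi> * real i + 2 * pi * real k"
    using m_real by (simp add: \<psi>_def field_simps)
  moreover have "cos (z + 2 * pi * real k) = cos z" "sin (z + 2 * pi * real k) = sin z" for z
    using cos_integer_2pi[of "real k"] sin_integer_2pi[of "real k"] by (simp_all add: cos_add sin_add)
  ultimately show ?thesis by (simp add: dir_def)
qed

lemma ctr_mod: "ctr t (i mod m) = ctr t i"
  using dir_periodic[of "i mod m" "i div m"] by (simp add: ctr_def)

lemma dist_ctr: "dist (ctr t i) (ctr t j) = 2 * \<rho> * \<bar>sin (\<psi> * (real i - real j))\<bar>"
proof -
  let ?a = "2 * \<psi> * real i" and ?b = "2 * \<psi> * real j"
  have d: "fst (ctr t i) - fst (ctr t j) = \<rho> * (cos ?a - cos ?b)"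
    "snd (ctr t i) - snd (ctr t j) = \<rho> * (sin ?a - sin ?b)"
    by (simp_all add: ctr_def dir_def right_diff_distrib)
  have "(dist (ctr t i) (ctr t j))\<^sup>2 = \<rho>\<^sup>2 * ((cos ?a - cos ?b)\<^sup>2 + (sin ?a - sin ?b)\<^sup>2)"
    unfolding dist_Pair_sq d by (simp only: power_mult_distrib distrib_left)
  also have "(cos ?a - cos ?b)\<^sup>2 + (sin ?a - sin ?b)\<^sup>2 = 2 - 2 * cos (?a - ?b)"
    unfolding cos_diff using sin_cos_squared_add[of ?a] sin_cos_squared_add[of ?b] by algebra
  also have "?a - ?b = 2 * (\<psi> * (real i - real j))" by (simp add: algebra_simps)
  also have "2 - 2 * cos (2 * (\<psi> * (real i - real j))) = 4 * (sin (\<psi> * (real i - real j)))\<^sup>2"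
    by (subst cos_double_sin) simp
  also have "\<rho>\<^sup>2 * (4 * (sin (\<psi> * (real i - real j)))\<^sup>2) = (2 * \<rho> * \<bar>sin (\<psi> * (real i - real j))\<bar>)\<^sup>2"
    by (simp add: power_mult_distrib)
  finally show ?thesis using rho_pos by (simp add: power2_eq_iff_nonneg)
qed

lemma dist_ctr_Suc: "dist (ctr t i) (ctr t (Suc i)) = \<l>"
  using rho_sin sin_psi by (simp add: dist_ctr abs_mult)

text \<open>Adjacent corners are closest: sin (\<psi> d) \<ge> sin \<psi> for 1 \<le> d < m, by
  monotonicity up to \<pi>/2 and reflection beyond. This separates the squares of the pattern and
  keeps points of other corners out of a lens.\<close>

lemma dist_ctr_ge:
  assumes "i < m" "j < m" "i \<noteq> j"
  shows "\<l> \<le> dist (ctr t i) (ctr t j)"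
proof -
  have *: "sin \<psi> \<le> sin (\<psi> * real d)" if "1 \<le> d" "d < m" for d
  proof (cases "\<psi> * real d \<le> pi / 2")
    case True
    have "\<psi> * 1 \<le> \<psi> * real d" using that psi_bounds(1) by (intro mult_left_mono) auto
    then show ?thesis using True psi_bounds(1) pi_gt_zero by (intro sin_monotone_2pi_le) linarith+
  next
    case False
    have "\<psi> * (real m - real d) \<ge> \<psi> * 1" using that psi_bounds(1) by (intro mult_left_mono) auto
    moreover have "\<psi> * real m = pi" using m_real by (simp add: \<psi>_def)
    ultimately have "\<psi> \<le> pi - \<psi> * real d" by (simp add: algebra_simps)
    then have "sin \<psi> \<le> sin (pi - \<psi> * real d)"
      using False psi_bounds(1) pi_gt_zero by (intro sin_monotone_2pi_le) linarith+
    then show ?thesis by simp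
  qed
  have "sin \<psi> \<le> \<bar>sin (\<psi> * (real i - real j))\<bar>"
  proof (cases "i < j")
    case True
    have "sin (\<psi> * (real i - real j)) = - sin (\<psi> * real (j - i))"
      using True by (simp add: of_nat_diff algebra_simps flip: sin_minus)
    moreover have "sin \<psi> \<le> sin (\<psi> * real (j - i))" using assms True by (intro *) auto
    ultimately show ?thesis by linarith
  next
    case False
    then have "sin (\<psi> * (real i - real j)) = sin (\<psi> * real (i - j))" by (simp add: of_nat_diff)
    moreover have "sin \<psi> \<le> sin (\<psi> * real (i - j))" using assms False by (intro *) auto
    ultimately show ?thesis by linarith
  qed
  then have "2 * \<rho> * sin \<psi> \<le> 2 * \<rho> * \<bar>sin (\<psi> * (real i - real j))\<bar>"
    using rho_pos by (intro mult_left_mono) auto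
  then show ?thesis by (simp add: dist_ctr rho_sin)
qed

text \<open>Tangential and radial coordinates, relative to the middle vertex, of a point within reach of
  both its neighbours: the lens has size $O(r/m^2)$ times $O(r/m)$.\<close>
lemma lens:
  fixes v t :: "real \<times> real" and i :: nat
  defines "u \<equiv> v - ctr t (Suc i)" and "c \<equiv> fst (dir (Suc i))" and "s \<equiv> snd (dir (Suc i))"
  assumes v: "dist v (ctr t i) \<le> r + \<eta>" "dist v (ctr t (Suc (Suc i))) \<le> r + \<eta>"
  shows "\<bar>snd u * c - fst u * s\<bar> \<le> 11 * \<eta>" "\<bar>fst u * c + snd u * s\<bar> \<le> 9 * (\<eta> * real m)"
proof -
  \<comment> \<open>Coordinates rotated to the middle corner, \<open>\<alpha>\<close> tangential and
    \<open>\<beta>\<close> radially outward. The neighbouring corners sit at (\<plusminus> k, -l),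
    because a side makes the angle \<open>\<psi>\<close> with the tangent.\<close>
  define \<alpha> where "\<alpha> = snd u * c - fst u * s"
  define \<beta> where "\<beta> = fst u * c + snd u * s"
  define k where "k = \<l> * cos \<psi>"
  define l where "l = \<l> * sin \<psi>"
  have cs: "c\<^sup>2 + s\<^sup>2 = 1" by (simp add: c_def s_def dir_def)
  let ?\<theta> = "2 * \<psi> * real (Suc i)"
  have dc: "\<rho> * (1 - cos (2 * \<psi>)) = l"
    using rho_sin by (simp add: l_def cos_double_sin power2_eq_square)
  have ds: "\<rho> * sin (2 * \<psi>) = k"
    using rho_sin by (simp add: k_def sin_double)
  have prev: "dir i = (c * cos (2 * \<psi>) + s * sin (2 * \<psi>), s * cos (2 * \<psi>) - c * sin (2 * \<psi>))"
  proof -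
    have "2 * \<psi> * real i = ?\<theta> - 2 * \<psi>" by (simp add: algebra_simps)
    then show ?thesis unfolding c_def s_def dir_def by (simp only: cos_diff sin_diff fst_conv snd_conv)
  qed
  have nxt: "dir (Suc (Suc i)) = (c * cos (2 * \<psi>) - s * sin (2 * \<psi>), s * cos (2 * \<psi>) + c * sin (2 * \<psi>))"
  proof -
    have "2 * \<psi> * real (Suc (Suc i)) = ?\<theta> + 2 * \<psi>" by (simp add: algebra_simps)
    then show ?thesis unfolding c_def s_def dir_def by (simp only: cos_add sin_add fst_conv snd_conv)
  qed
  have v_eq: "fst v = fst u + fst t + \<rho> * c" "snd v = snd u + snd t + \<rho> * s"
    by (simp_all add: u_def c_def s_def ctr_def)
  have id: "(x + p * c + q * s)\<^sup>2 + (y + p * s - q * c)\<^sup>2 = (y * c - x * s - q)\<^sup>2 + (x * c + y * s + p)\<^sup>2"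
    for x y p q using cs by algebra
  have "(dist v (ctr t (Suc (Suc i))))\<^sup>2 = (fst u + l * c + k * s)\<^sup>2 + (snd u + l * s - k * c)\<^sup>2"
    unfolding dist_Pair_sq ctr_def nxt using v_eq
    by (simp add: algebra_simps flip: dc ds)
  then have d2: "(dist v (ctr t (Suc (Suc i))))\<^sup>2 = (\<alpha> - k)\<^sup>2 + (\<beta> + l)\<^sup>2"
    using id[of "fst u" l k "snd u"] by (simp add: \<alpha>_def \<beta>_def)
  have "(dist v (ctr t i))\<^sup>2 = (fst u + l * c + (- k) * s)\<^sup>2 + (snd u + l * s - (- k) * c)\<^sup>2"
    unfolding dist_Pair_sq ctr_def prev using v_eq
    by (simp add: algebra_simps flip: dc ds)
  then have d1: "(dist v (ctr t i))\<^sup>2 = (\<alpha> + k)\<^sup>2 + (\<beta> + l)\<^sup>2"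
    using id[of "fst u" l "- k" "snd u"] by (simp add: \<alpha>_def \<beta>_def)
  have "(\<alpha> - k)\<^sup>2 + (\<beta> + l)\<^sup>2 \<le> (r + \<eta>)\<^sup>2" "(\<alpha> + k)\<^sup>2 + (\<beta> + l)\<^sup>2 \<le> (r + \<eta>)\<^sup>2"
    using v unfolding d1[symmetric] d2[symmetric] by (auto intro: power_mono)
  from lens_bounds[OF this] r_pos eta_pos
  have b: "\<bar>\<alpha>\<bar> \<le> r + \<eta> - k" "(\<beta> + l)\<^sup>2 \<le> (r + \<eta>)\<^sup>2 - k\<^sup>2" by auto
  \<comment> \<open>The loss from \<l> to k = \<l> cos \<psi> is at most 8 \<eta>; with r - \<l> = 2
    \<eta> and the displacement \<open>\<eta>\<close> this yields 11 \<eta>.\<close>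
  have psi2: "\<l> * (\<psi>\<^sup>2 / 2) \<le> 8 * \<eta>"
  proof -
    have "\<psi>\<^sup>2 \<le> (4 / real m)\<^sup>2" using psi_bounds by (intro power_mono) auto
    then have "\<psi>\<^sup>2 / 2 \<le> 8 / (real m)\<^sup>2" by (simp add: power_divide)
    then have "\<l> * (\<psi>\<^sup>2 / 2) \<le> r * (8 / (real m)\<^sup>2)"
      using l_pos eta_pos r_pos by (intro mult_mono) (auto simp: \<l>_def)
    then show ?thesis by (simp add: \<eta>_def)
  qed
  have "\<l> * (1 - \<psi>\<^sup>2 / 2) \<le> k"
    unfolding k_def using l_pos cos_ge_1_minus by (intro mult_left_mono) auto
  then have "\<l> - \<l> * (\<psi>\<^sup>2 / 2) \<le> k" by (simp only: right_diff_distrib mult_1_right)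
  then have "k \<ge> r - 10 * \<eta>" using psi2 \<l>_def by linarith
  with b(1) show "\<bar>snd u * c - fst u * s\<bar> \<le> 11 * \<eta>" by (simp add: \<alpha>_def)
  have "sin \<psi> \<le> 4 / real m" using sin_x_le_x[of \<psi>] psi_bounds by linarith
  then have "l \<le> r * (4 / real m)"
    unfolding l_def using l_pos sin_psi eta_pos r_pos by (intro mult_mono) (auto simp: \<l>_def)
  also have "r * (4 / real m) = 4 * (\<eta> * real m)"
    using m_real by (simp add: \<eta>_def power2_eq_square)
  finally have l: "l \<le> 4 * (\<eta> * real m)" .
  have "l \<ge> 0" using l_pos sin_psi by (simp add: l_def)
  \<comment> \<open>Since r \<eta> = (\<eta> m)^2, the right side of the radial bound is at most (6
    + 16) (\<eta> m)^2, below (5 \<eta> m)^2; together with l \<le> 4 \<eta> m this gives 9.\<close>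
  have "k\<^sup>2 = \<l>\<^sup>2 - l\<^sup>2"
    by (simp add: k_def l_def power_mult_distrib cos_squared_eq algebra_simps)
  with b(2) have "(\<beta> + l)\<^sup>2 \<le> (r + \<eta>)\<^sup>2 - \<l>\<^sup>2 + l\<^sup>2" by simp
  also have "(r + \<eta>)\<^sup>2 - \<l>\<^sup>2 \<le> 6 * (r * \<eta>)"
    using eta_pos by (simp add: \<l>_def power2_eq_square algebra_simps)
  also have "6 * (r * \<eta>) = 6 * (\<eta> * real m)\<^sup>2" by (simp add: \<eta>_def power2_eq_square)
  also have "l\<^sup>2 \<le> (4 * (\<eta> * real m))\<^sup>2" using l \<open>l \<ge> 0\<close> by (intro power_mono)
  also have "6 * (\<eta> * real m)\<^sup>2 + (4 * (\<eta> * real m))\<^sup>2 \<le> (5 * (\<eta> * real m))\<^sup>2"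
    by (simp add: power_mult_distrib)
  finally have "\<bar>\<beta> + l\<bar> \<le> 5 * (\<eta> * real m)"
    using eta_pos power2_le_iff_abs_le[of "5 * (\<eta> * real m)" "\<beta> + l"] by simp
  with l \<open>l \<ge> 0\<close> show "\<bar>fst u * c + snd u * s\<bar> \<le> 9 * (\<eta> * real m)"
    by (simp add: \<beta>_def)
qed

text \<open>The two facts exclude the two kinds of dominating vertices: membership in
  \<open>Q\<close> excludes points outside the pattern, and closeness to the middle corner excludes
  the points of all other corners.\<close>

lemma lens_subset:
  assumes v: "dist v (ctr t i) \<le> r + \<eta>" "dist v (ctr t (Suc (Suc i))) \<le> r + \<eta>"
  shows "v \<in> Q t" "dist v (ctr t (Suc i)) < \<l> - \<eta>"
proof -
  define u where "u = v - ctr t (Suc i)"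
  define c where "c = fst (dir (Suc i))"
  define s where "s = snd (dir (Suc i))"
  define \<alpha> where "\<alpha> = snd u * c - fst u * s"
  define \<beta> where "\<beta> = fst u * c + snd u * s"
  have \<alpha>: "\<bar>\<alpha>\<bar> \<le> 11 * \<eta>" and \<beta>: "\<bar>\<beta>\<bar> \<le> 9 * (\<eta> * real m)"
    using lens[OF v] by (simp_all add: u_def c_def s_def \<alpha>_def \<beta>_def)
  have cs: "c\<^sup>2 + s\<^sup>2 = 1" by (simp add: c_def s_def dir_def)
  have u_eq: "fst u = \<beta> * c - \<alpha> * s" "snd u = \<beta> * s + \<alpha> * c"
    using cs unfolding \<alpha>_def \<beta>_def by algebra+
  have d: "dist v (ctr t (Suc i) + b *\<^sub>R dir (Suc i)) \<le> \<bar>\<alpha>\<bar> + \<bar>\<beta> - b\<bar>" for b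
  proof -
    have "(dist v (ctr t (Suc i) + b *\<^sub>R dir (Suc i)))\<^sup>2 = (fst u - b * c)\<^sup>2 + (snd u - b * s)\<^sup>2"
      by (simp add: dist_Pair_sq u_def c_def s_def algebra_simps)
    also have "\<dots> = \<alpha>\<^sup>2 + (\<beta> - b)\<^sup>2" unfolding u_eq using cs by algebra
    also have "\<dots> \<le> (\<bar>\<alpha>\<bar> + \<bar>\<beta> - b\<bar>)\<^sup>2" by (simp add: power2_sum)
    finally show ?thesis by (rule power2_le_imp_le) simp
  qed
  have "dist v (ctr t (Suc i)) \<le> 11 * \<eta> + 9 * (\<eta> * real m)"
    using d[of 0] \<alpha> \<beta> by simp
  then show "dist v (ctr t (Suc i)) < \<l> - \<eta>"
    unfolding \<l>_def using r_ge eta_pos by linarith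
  define k where "k = \<lfloor>\<beta> / \<eta>\<rfloor>"
  have k: "of_int k * \<eta> \<le> \<beta>" "\<beta> < (of_int k + 1) * \<eta>"
  proof -
    have "of_int k \<le> \<beta> / \<eta>" "\<beta> / \<eta> < of_int k + 1" unfolding k_def by linarith+
    then show "of_int k * \<eta> \<le> \<beta>" "\<beta> < (of_int k + 1) * \<eta>"
      using eta_pos by (simp_all add: pos_le_divide_eq pos_divide_less_eq)
  qed
  have "\<beta> / \<eta> \<le> 9 * real m" "\<beta> / \<eta> \<ge> - (9 * real m)"
    using \<beta> eta_pos by (auto simp: field_simps abs_le_iff)
  then have k_range: "k \<in> {- (9 * int m) - 1..9 * int m}"
    unfolding k_def atLeastAtMost_iff by linarith
  \<comment> \<open>\<open>lens\<close> works with unreduced indices, while \<open>Q\<close> runs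
    over \<open>i < m\<close> only.\<close>
  define j where "j = Suc i mod m"
  have "dist v (ctr t (Suc i) + (of_int k * \<eta>) *\<^sub>R dir (Suc i)) \<le> 12 * \<eta>"
    using d[of "of_int k * \<eta>"] \<alpha> k by (simp add: algebra_simps)
  then have "v \<in> sq (ctr t (Suc i) + (of_int k * \<eta>) *\<^sub>R dir (Suc i)) (12 * \<eta>)"
    by (rule mem_sq_of_dist)
    moreover have "ctr t (Suc i) = ctr t j" "dir (Suc i) = dir j"
    using ctr_mod dir_periodic[of "Suc i mod m" "Suc i div m"] by (simp_all add: j_def)
  ultimately have "v \<in> sq (ctr t j + (of_int k * \<eta>) *\<^sub>R dir j) (12 * \<eta>)" by simp
  moreover have "j < m" using m_ge by (simp add: j_def)
  ultimately show "v \<in> Q t" unfolding Q_def using k_range by blast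
qed

end

section \<open>The polygon as a local pattern\<close>

lemma mem_closed_nbhd_rgg:
  assumes "r \<ge> 0"
  shows "w \<in> closed_nbhd {..<n} (rgg_adj x r) v \<longleftrightarrow> w < n \<and> dist (x v) (x w) \<le> r"
  using assms by (auto simp: closed_nbhd_def rgg_adj_def)

context rgg_polygon
begin

text \<open>From corner \<open>i\<close> the robber can reach both adjacent corners, as \<l> + 2
  \<eta> = r. A cop at \<open>v\<close> controlling both would be in the lens, hence in
  \<open>Q\<close>, hence on a pattern point of another corner \<open>j\<close>; but that point is
  within \<open>\<eta>\<close> of a corner at distance at least \<open>\<l>\<close> from corner
  \<open>i\<close>, too far away for the lens.\<close>

lemma escape:
  assumes "has_pattern n (Ps t) (Q t) x"
  shows "\<not> cops_win {..<n} (rgg_adj x r) 1"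
proof -
  from assms obtain xs where xs: "pattern_at n (Ps t) (Q t) x xs" by (auto simp: has_pattern_def)
  then have len: "length xs = m" and "distinct xs" and sub: "set xs \<subseteq> {..<n}"
    by (auto simp: pattern_at_def Ps_def dest: list_all2_lengthD)
  have near: "dist (x (xs ! j)) (ctr t j) \<le> \<eta>" if "j < m" for j
  proof -
    have "x (xs ! j) \<in> Ps t ! j" using xs that len by (auto simp: pattern_at_def list_all2_conv_all_nth)
    then have "x (xs ! j) \<in> sq (ctr t j) (\<eta> / 2)" using that by (simp add: Ps_def)
    then show ?thesis using dist_of_mem_sq by fastforce
  qed
  note nbhd = mem_closed_nbhd_rgg[OF order.strict_implies_order[OF r_pos]]
  show ?thesis
  proof (rule robber_evades_one_cop)
    show "set xs \<subseteq> {..<n}" by (rule sub)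
    show "xs ! 0 \<in> set xs" "xs ! 1 \<in> set xs" "xs ! 0 \<noteq> xs ! 1"
      using len m_ge \<open>distinct xs\<close> by (auto simp: nth_eq_iff_index_eq)
    fix s v assume "s \<in> set xs" and v: "v \<in> {..<n}" "v \<noteq> s"
    then obtain i where i: "i < m" "s = xs ! i" using len by (auto simp: in_set_conv_nth)
    \<comment> \<open>The cyclic predecessor of \<open>i\<close>, shifted by \<open>m\<close> so
      that the subtraction is not truncated at \<open>i = 0\<close>.\<close>
    define i' where "i' = i + m - 1"
    define a where "a = i' mod m"
    define b where "b = Suc (Suc i') mod m"
    have ab: "a < m" "b < m" using m_ge by (auto simp: a_def b_def)
    then have ab_in: "xs ! a \<in> set xs" "xs ! b \<in> set xs" using len by auto
    have Suc_i': "Suc i' mod m = i" using i m_ge by (simp add: i'_def)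
    have ctr_a: "ctr t i' = ctr t a" and ctr_i: "ctr t (Suc i') = ctr t i"
      and ctr_b: "ctr t (Suc (Suc i')) = ctr t b"
      unfolding a_def b_def using ctr_mod[of t i'] ctr_mod[of t "Suc i'"] ctr_mod[of t "Suc (Suc i')"] Suc_i'
      by simp_all
    have da: "dist (ctr t a) (ctr t i) = \<l>" using dist_ctr_Suc[of t i'] by (simp add: ctr_a ctr_i)
    have db: "dist (ctr t i) (ctr t b) = \<l>" using dist_ctr_Suc[of t "Suc i'"] by (simp only: ctr_b ctr_i)
    have sa: "dist (x s) (x (xs ! a)) \<le> r"
      using dist_triangle[of "x s" "x (xs ! a)" "ctr t i"] dist_triangle[of "ctr t i" "x (xs ! a)" "ctr t a"]
        near[OF i(1)] near[OF ab(1)] da i(2) \<l>_def by (simp add: dist_commute)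
    have sb: "dist (x s) (x (xs ! b)) \<le> r"
      using dist_triangle[of "x s" "x (xs ! b)" "ctr t i"] dist_triangle[of "ctr t i" "x (xs ! b)" "ctr t b"]
        near[OF i(1)] near[OF ab(2)] db i(2) \<l>_def by (simp add: dist_commute)
    have far: "\<not> (dist (x v) (x (xs ! a)) \<le> r \<and> dist (x v) (x (xs ! b)) \<le> r)"
    proof
      assume va: "dist (x v) (x (xs ! a)) \<le> r \<and> dist (x v) (x (xs ! b)) \<le> r"
      have "dist (x v) (ctr t a) \<le> r + \<eta>" "dist (x v) (ctr t b) \<le> r + \<eta>"
        using va near[OF ab(1)] near[OF ab(2)]
          dist_triangle[of "x v" "ctr t a" "x (xs ! a)"] dist_triangle[of "x v" "ctr t b" "x (xs ! b)"]
        by auto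
      then have "x v \<in> Q t" and vi: "dist (x v) (ctr t i) < \<l> - \<eta>"
        using lens_subset[of "x v" t i'] by (simp_all add: ctr_a ctr_b ctr_i)
      then have "v \<in> set xs" using xs v by (auto simp: pattern_at_def)
      then obtain j where j: "j < m" "v = xs ! j" using len by (auto simp: in_set_conv_nth)
      then have "i \<noteq> j" using v(2) i by auto
      then have "\<l> \<le> dist (ctr t i) (ctr t j)" using dist_ctr_ge i j by simp
      also have "\<dots> \<le> dist (x v) (ctr t i) + dist (x v) (ctr t j)" by (rule dist_triangle3)
      also have "\<dots> < \<l>" using vi near[OF j(1)] j(2) by simp
      finally show False by simp
    qed
    show "\<exists>s'\<in>set xs. s' \<in> closed_nbhd {..<n} (rgg_adj x r) s \<and> s' \<notin> closed_nbhd {..<n} (rgg_adj x r) v"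
      unfolding nbhd using far sa sb ab_in sub by blast
  qed
qed

lemma Q_borel: "Q t \<in> sets borel"
  unfolding Q_def by (intro sets.finite_UN) auto

text \<open>Overlaps are ignored: \<open>m\<close> rows of 18 m + 2 \<le> 20 m squares of area 576
  \<eta>^2 each, and 20 times 576 is 11520.\<close>

lemma emeasure_Q: "emeasure lborel (Q t) \<le> ennreal (11520 * r\<^sup>2 / (real m)\<^sup>2)"
proof -
  have inner: "emeasure lborel (\<Union>k\<in>{- (9 * int m) - 1..9 * int m}.
      sq (ctr t i + (of_int k * \<eta>) *\<^sub>R dir i) (12 * \<eta>)) \<le> ennreal ((18 * real m + 2) * (24 * \<eta>)\<^sup>2)" for i
  proof -
    have "emeasure lborel (\<Union>k\<in>{- (9 * int m) - 1..9 * int m}.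
      sq (ctr t i + (of_int k * \<eta>) *\<^sub>R dir i) (12 * \<eta>)) \<le>
      (\<Sum>k\<in>{- (9 * int m) - 1..9 * int m}. emeasure lborel (sq (ctr t i + (of_int k * \<eta>) *\<^sub>R dir i) (12 * \<eta>)))"
      by (rule emeasure_subadditive_finite) auto
    also have "\<dots> = (\<Sum>k\<in>{- (9 * int m) - 1..9 * int m}. ennreal ((24 * \<eta>)\<^sup>2))"
      using eta_pos by (simp add: emeasure_sq)
    also have "\<dots> = ennreal (\<Sum>k\<in>{- (9 * int m) - 1..9 * int m}. (24 * \<eta>)\<^sup>2)"
      by (rule sum_ennreal) simp
    also have "(\<Sum>k\<in>{- (9 * int m) - 1..9 * int m}. (24 * \<eta>)\<^sup>2) = (18 * real m + 2) * (24 * \<eta>)\<^sup>2"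
      by (simp add: nat_add_distrib)
    finally show ?thesis .
  qed
  have "emeasure lborel (Q t) \<le> (\<Sum>i<m. emeasure lborel (\<Union>k\<in>{- (9 * int m) - 1..9 * int m}.
      sq (ctr t i + (of_int k * \<eta>) *\<^sub>R dir i) (12 * \<eta>)))"
    unfolding Q_def by (rule emeasure_subadditive_finite) auto
  also have "\<dots> \<le> (\<Sum>i<m. ennreal ((18 * real m + 2) * (24 * \<eta>)\<^sup>2))"
    by (intro sum_mono inner)
  also have "\<dots> = ennreal (\<Sum>i<m. (18 * real m + 2) * (24 * \<eta>)\<^sup>2)"
    by (rule sum_ennreal) simp
  also have "\<dots> \<le> ennreal (11520 * r\<^sup>2 / (real m)\<^sup>2)"
  proof (rule ennreal_leI)
    have "(\<Sum>i<m. (18 * real m + 2) * (24 * \<eta>)\<^sup>2) = real m * (18 * real m + 2) * (576 * \<eta>\<^sup>2)"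
      by (simp add: power_mult_distrib)
    also have "\<dots> \<le> real m * (20 * real m) * (576 * \<eta>\<^sup>2)"
      using m_real by (intro mult_mono) auto
    also have "\<dots> = 11520 * r\<^sup>2 / (real m)\<^sup>2"
      using m_real by (simp add: \<eta>_def power2_eq_square)
    finally show "(\<Sum>i<m. (18 * real m + 2) * (24 * \<eta>)\<^sup>2) \<le> 11520 * r\<^sup>2 / (real m)\<^sup>2" .
  qed
  finally show ?thesis .
qed

lemma Q_box:
  assumes "v \<in> Q t"
  shows "\<bar>fst v - fst t\<bar> < r * real m \<and> \<bar>snd v - snd t\<bar> < r * real m"
proof -
  from assms obtain i k where ik: "k \<in> {- (9 * int m) - 1..9 * int m}"
    "v \<in> sq (ctr t i + (of_int k * \<eta>) *\<^sub>R dir i) (12 * \<eta>)"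
    by (auto simp: Q_def)
  have k_le: "\<bar>real_of_int k\<bar> \<le> 9 * real m + 1" using ik(1) by auto
  have k: "\<bar>\<rho> + of_int k * \<eta>\<bar> \<le> \<rho> + (9 * real m + 1) * \<eta>"
  proof -
    have "\<bar>of_int k * \<eta>\<bar> = \<bar>real_of_int k\<bar> * \<eta>" using eta_pos by (simp add: abs_mult)
    also have "\<dots> \<le> (9 * real m + 1) * \<eta>"
      using eta_pos k_le by (intro mult_right_mono) auto
    finally show ?thesis using rho_pos by linarith
  qed
  have bound: "\<bar>y\<bar> < r * real m" if "\<bar>y - (\<rho> + of_int k * \<eta>) * w\<bar> \<le> 12 * \<eta>" "\<bar>w\<bar> \<le> 1" for y w
  proof -
    have "\<bar>(\<rho> + of_int k * \<eta>) * w\<bar> \<le> \<bar>\<rho> + of_int k * \<eta>\<bar> * 1"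
      unfolding abs_mult using that(2) by (intro mult_left_mono) auto
    with that(1) k have "\<bar>y\<bar> \<le> \<rho> + 9 * (\<eta> * real m) + 13 * \<eta>" by (simp add: algebra_simps)
    moreover have "r * 16 \<le> r * real m" using r_pos m_real by simp
    ultimately show ?thesis using rho_le r_ge eta_pos r_pos by linarith
  qed
  have "\<bar>(fst v - fst t) - (\<rho> + of_int k * \<eta>) * fst (dir i)\<bar> \<le> 12 * \<eta>"
    "\<bar>(snd v - snd t) - (\<rho> + of_int k * \<eta>) * snd (dir i)\<bar> \<le> 12 * \<eta>"
    using ik(2) by (simp_all add: mem_sq ctr_def algebra_simps)
  then show ?thesis using bound abs_dir_le by blast
qed

lemma length_Ps: "length (Ps t) = m" by (simp add: Ps_def)

lemma Ps_facts:
  assumes "P \<in> set (Ps t)"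
  shows "P \<in> sets borel" "emeasure lborel P = ennreal (\<eta>\<^sup>2)" "P \<subseteq> Q t"
proof -
  from assms obtain i where i: "i < m" "P = sq (ctr t i) (\<eta> / 2)" by (auto simp: Ps_def)
  then show "P \<in> sets borel" "emeasure lborel P = ennreal (\<eta>\<^sup>2)"
    using eta_pos by (simp_all add: emeasure_sq)
  have "P \<subseteq> sq (ctr t i + (of_int 0 * \<eta>) *\<^sub>R dir i) (12 * \<eta>)"
    using eta_pos unfolding i(2) by (auto simp: mem_sq)
  moreover have "0 \<in> {- (9 * int m) - 1..9 * int m}" by simp
  ultimately show "P \<subseteq> Q t" unfolding Q_def using i(1) by blast
qed

lemma Ps_disjoint:
  assumes "j < m" "k < m" "j \<noteq> k"
  shows "Ps t ! j \<inter> Ps t ! k = {}"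
proof (rule ccontr)
  assume "Ps t ! j \<inter> Ps t ! k \<noteq> {}"
  then obtain v where "v \<in> sq (ctr t j) (\<eta> / 2)" "v \<in> sq (ctr t k) (\<eta> / 2)"
    using assms by (auto simp: Ps_def)
  then have "dist v (ctr t j) \<le> \<eta>" "dist v (ctr t k) \<le> \<eta>"
    using dist_of_mem_sq by fastforce+
  then have "dist (ctr t j) (ctr t k) \<le> 2 * \<eta>" using dist_triangle3[of "ctr t j" "ctr t k" v] by linarith
  with dist_ctr_ge[OF assms, of t] r_ge eta_pos \<l>_def show False by linarith
qed

end

section \<open>Two isolated vertices\<close>

text \<open>The scale \<open>\<nu>\<close>, later 1 / sqrt n, replaces \<open>r\<close>: since
  \<open>r\<close> may be arbitrarily small, squares of side \<open>r\<close> could be practically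
  always empty.\<close>

locale rgg_isolated_pair =
  fixes r \<nu> :: real
  assumes r_pos: "0 < r" and r_le: "r \<le> \<nu>"
begin

definition ctr :: "real \<times> real \<Rightarrow> nat \<Rightarrow> real \<times> real" where
  "ctr t i = t + (6 * \<nu> * real i, 0)"

definition Ps :: "real \<times> real \<Rightarrow> (real \<times> real) set list" where
  "Ps t = map (\<lambda>i. sq (ctr t i) (\<nu> / 2)) [0..<2]"

text \<open>Half side 2 \<nu> leaves room for everything within \<open>r\<close> of a point in the
  inner square of half side \<nu> / 2, as \<nu> / 2 + r \<le> 3 \<nu> / 2. The spacing 6 \<nu> of
  the centres keeps the two pattern points themselves non-adjacent.\<close>

definition Q :: "real \<times> real \<Rightarrow> (real \<times> real) set" where
  "Q t = (\<Union>i<2. sq (ctr t i) (2 * \<nu>))"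

lemma nu_pos: "\<nu> > 0" using r_pos r_le by simp

lemma ctr_separated: "i \<noteq> j \<Longrightarrow> 6 * \<nu> \<le> \<bar>fst (ctr t i) - fst (ctr t j)\<bar>"
proof -
  assume "i \<noteq> j"
  then have "1 \<le> \<bar>real i - real j\<bar>" by linarith
  then have "6 * \<nu> * 1 \<le> 6 * \<nu> * \<bar>real i - real j\<bar>" using nu_pos by (intro mult_left_mono) auto
  also have "\<dots> = \<bar>fst (ctr t i) - fst (ctr t j)\<bar>"
    using nu_pos by (simp add: ctr_def abs_mult flip: right_diff_distrib)
  finally show ?thesis by simp
qed

text \<open>Both pattern points are isolated, so staying put is always a safe move as long as the
  cop stands elsewhere.\<close>

lemma escape:
  assumes "has_pattern n (Ps t) (Q t) x"
  shows "\<not> cops_win {..<n} (rgg_adj x r) 1"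
proof -
  from assms obtain xs where xs: "pattern_at n (Ps t) (Q t) x xs" by (auto simp: has_pattern_def)
  then have len: "length xs = 2" and "distinct xs" and sub: "set xs \<subseteq> {..<n}"
    by (auto simp: pattern_at_def Ps_def dest: list_all2_lengthD)
  have near: "\<bar>fst (x (xs ! j)) - fst (ctr t j)\<bar> \<le> \<nu> / 2" "\<bar>snd (x (xs ! j)) - snd (ctr t j)\<bar> \<le> \<nu> / 2"
    if "j < 2" for j
  proof -
    have "x (xs ! j) \<in> Ps t ! j" using xs that len by (auto simp: pattern_at_def list_all2_conv_all_nth)
    moreover have "Ps t ! j = sq (ctr t j) (\<nu> / 2)" using that unfolding Ps_def by (subst nth_map) auto
    ultimately show "\<bar>fst (x (xs ! j)) - fst (ctr t j)\<bar> \<le> \<nu> / 2"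
      "\<bar>snd (x (xs ! j)) - snd (ctr t j)\<bar> \<le> \<nu> / 2" by (auto simp: mem_sq)
  qed
  note nbhd = mem_closed_nbhd_rgg[OF order.strict_implies_order[OF r_pos]]
  show ?thesis
  proof (rule robber_evades_one_cop)
    show "set xs \<subseteq> {..<n}" by (rule sub)
    show "xs ! 0 \<in> set xs" "xs ! 1 \<in> set xs" "xs ! 0 \<noteq> xs ! 1"
      using len \<open>distinct xs\<close> by (auto simp: nth_eq_iff_index_eq)
    fix s v assume s: "s \<in> set xs" and v: "v \<in> {..<n}" "v \<noteq> s"
    then obtain i where i: "i < 2" "s = xs ! i" using len by (auto simp: in_set_conv_nth)
    have "\<not> dist (x v) (x s) \<le> r"
    proof
      assume "dist (x v) (x s) \<le> r"
      then have d: "\<bar>fst (x v) - fst (x s)\<bar> \<le> \<nu>" "\<bar>snd (x v) - snd (x s)\<bar> \<le> \<nu>"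
        using r_le dist_fst_le[of "x v" "x s"] dist_snd_le[of "x v" "x s"] by (auto simp: dist_real_def)
      then have "x v \<in> sq (ctr t i) (2 * \<nu>)"
        using near[OF i(1)] unfolding mem_sq i(2) by linarith
      then have "x v \<in> Q t" using i(1) by (auto simp: Q_def)
      then have "v \<in> set xs" using xs v by (auto simp: pattern_at_def)
      then obtain j where j: "j < 2" "v = xs ! j" using len by (auto simp: in_set_conv_nth)
      then have "i \<noteq> j" using v(2) i by auto
      from ctr_separated[OF this, of t] d(1) nu_pos
        near(1)[OF i(1), folded i(2)] near(1)[OF j(1), folded j(2)]
      show False by linarith
    qed
    then show "\<exists>s'\<in>set xs. s' \<in> closed_nbhd {..<n} (rgg_adj x r) s \<and> s' \<notin> closed_nbhd {..<n} (rgg_adj x r) v"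
      unfolding nbhd using s sub r_pos by (intro bexI[of _ s]) auto
  qed
qed

lemma Q_borel: "Q t \<in> sets borel"
  unfolding Q_def by (intro sets.finite_UN) auto

lemma emeasure_Q: "emeasure lborel (Q t) \<le> ennreal (32 * \<nu>\<^sup>2)"
proof -
  have "emeasure lborel (Q t) \<le> (\<Sum>i<(2::nat). emeasure lborel (sq (ctr t i) (2 * \<nu>)))"
    unfolding Q_def by (rule emeasure_subadditive_finite) auto
  also have "\<dots> = (\<Sum>i<(2::nat). ennreal ((4 * \<nu>)\<^sup>2))"
    using nu_pos by (simp add: emeasure_sq)
  also have "\<dots> = ennreal (\<Sum>i<(2::nat). (4 * \<nu>)\<^sup>2)"
    by (rule sum_ennreal) simp
  also have "(\<Sum>i<(2::nat). (4 * \<nu>)\<^sup>2) = 32 * \<nu>\<^sup>2" by (simp add: power_mult_distrib)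
  finally show ?thesis .
qed

lemma Q_box:
  assumes "v \<in> Q t"
  shows "\<bar>fst v - fst t\<bar> < 10 * \<nu> \<and> \<bar>snd v - snd t\<bar> < 10 * \<nu>"
proof -
  from assms obtain i :: nat where i: "i < 2" "v \<in> sq (ctr t i) (2 * \<nu>)" by (auto simp: Q_def)
  from i(1) have "i = 0 \<or> i = 1" by auto
  with i(2) nu_pos show ?thesis by (auto simp: mem_sq ctr_def)
qed

lemma length_Ps: "length (Ps t) = 2" by (simp add: Ps_def)

lemma Ps_facts:
  assumes "P \<in> set (Ps t)"
  shows "P \<in> sets borel" "emeasure lborel P = ennreal (\<nu>\<^sup>2)" "P \<subseteq> Q t"
proof -
  from assms obtain i where i: "i < 2" "P = sq (ctr t i) (\<nu> / 2)" by (auto simp: Ps_def)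
  then show "P \<in> sets borel" "emeasure lborel P = ennreal (\<nu>\<^sup>2)"
    using nu_pos by (simp_all add: emeasure_sq)
  have "P \<subseteq> sq (ctr t i) (2 * \<nu>)"
    using nu_pos unfolding i(2) by (auto simp: mem_sq)
  then show "P \<subseteq> Q t" unfolding Q_def using i(1) by blast
qed

lemma Ps_disjoint:
  assumes "j < 2" "k < 2" "j \<noteq> k"
  shows "Ps t ! j \<inter> Ps t ! k = {}"
proof (rule ccontr)
  assume "Ps t ! j \<inter> Ps t ! k \<noteq> {}"
  moreover have "Ps t ! i = sq (ctr t i) (\<nu> / 2)" if "i < 2" for i
    using that unfolding Ps_def by (subst nth_map) auto
  ultimately obtain v where "v \<in> sq (ctr t j) (\<nu> / 2)" "v \<in> sq (ctr t k) (\<nu> / 2)"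
    using assms by auto
  then have "\<bar>fst v - fst (ctr t j)\<bar> \<le> \<nu> / 2" "\<bar>fst v - fst (ctr t k)\<bar> \<le> \<nu> / 2"
    by (auto simp: mem_sq)
  then show False using ctr_separated[OF assms(3), of t] nu_pos by linarith
qed

end

section \<open>Asymptotics\<close>

abbreviation cop_prob :: "nat \<Rightarrow> real \<Rightarrow> real" where
  "cop_prob n r \<equiv> measure (rgg_space n) {x \<in> space (rgg_space n). cop_number {..<n} (rgg_adj x r) > 1}"

text \<open>For q \<le> 1/2 the bound ln (1 - q) \<ge> - q - 2 q^2 is at least - 2 q.\<close>

lemma exp_le_one_minus_power:
  fixes q :: real
  assumes "0 \<le> q" "q \<le> 1 / 2"
  shows "exp (- 2 * q * real n) \<le> (1 - q) ^ n"
proof -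
  have "q * q \<le> q * (1 / 2)" using assms by (intro mult_left_mono) auto
  then have "- 2 * q \<le> ln (1 - q)"
    using ln_one_minus_pos_lower_bound[OF assms] by (simp add: power2_eq_square)
  then have "exp (- 2 * q) \<le> 1 - q"
    using assms by (simp add: ln_ge_iff)
  then have "exp (- 2 * q) ^ n \<le> (1 - q) ^ n" by (intro power_mono) auto
  then show ?thesis by (simp flip: exp_of_nat2_mult)
qed

lemma nat_floor_ge_half:
  fixes y :: real
  assumes "y \<ge> 2"
  shows "y / 2 \<le> real (nat \<lfloor>y\<rfloor>)" "nat \<lfloor>y\<rfloor> > 0" "real (nat \<lfloor>y\<rfloor>) \<le> y"
  using assms by linarith+

text \<open>With \<nu>^2 = 1 / n the occurrence probability in one box is bounded below by a
  positive constant: n \<nu>^2 / 2 = 1/2 for each of the two points, and q = 32 / n for the empty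
  region. Only the number of boxes grows, at least n / 1600.\<close>

lemma cop_prob_sparse:
  assumes r: "0 < r" "r \<le> 1 / sqrt (real n)" and n: "n \<ge> 1600"
  shows "cop_prob n r \<ge>
    1 - (1 / ((sqrt (real n) / 40)\<^sup>2 * (1 / 4 * exp (- 64))) + (1 / (1 - 128 / real n) - 1))"
proof -
  define \<nu> where "\<nu> = 1 / sqrt (real n)"
  interpret rgg_isolated_pair r \<nu> by standard (use r in \<open>auto simp: \<nu>_def\<close>)
  have sqrt: "sqrt (real n) \<ge> 40" using n by (simp add: real_le_rsqrt)
  define g where "g = nat \<lfloor>sqrt (real n) / 20\<rfloor>"
  have g: "sqrt (real n) / 40 \<le> real g" "g > 0" "real g \<le> sqrt (real n) / 20"
    using nat_floor_ge_half[of "sqrt (real n) / 20"] sqrt by (auto simp: g_def)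
  have nu2: "\<nu>\<^sup>2 = 1 / real n" using n by (simp add: \<nu>_def power_divide)
  have nu2_le: "\<nu>\<^sup>2 \<le> 1 / 1600" unfolding nu2 using n by (intro divide_left_mono) auto
  have B: "2 * (10 * \<nu>) * real g \<le> 1" using g(3) n by (simp add: \<nu>_def pos_divide_le_eq)
  have "cop_prob n r \<ge> 1 - (1 / ((real g)\<^sup>2 * ((real n * \<nu>\<^sup>2 / 2) ^ 2 * (1 - 32 * \<nu>\<^sup>2) ^ n))
      + (1 / (1 - 2 * real 2 * (32 * \<nu>\<^sup>2)) - 1))"
    by (rule rgg_cop_number_gt_1_bound[where Ps = Ps and Q = Q, OF g(2) B _ length_Ps Ps_facts Ps_disjoint
          Q_borel emeasure_Q Q_box escape])
      (use nu_pos n nu2_le in auto)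
  moreover have "1 / ((real g)\<^sup>2 * ((real n * \<nu>\<^sup>2 / 2) ^ 2 * (1 - 32 * \<nu>\<^sup>2) ^ n)) \<le>
     1 / ((sqrt (real n) / 40)\<^sup>2 * (1 / 4 * exp (- 64)))"
  proof (rule divide_left_mono)
    have "exp (- 2 * (32 * \<nu>\<^sup>2) * real n) \<le> (1 - 32 * \<nu>\<^sup>2) ^ n"
      using n nu2 by (intro exp_le_one_minus_power) auto
    then have "exp (- 64) \<le> (1 - 32 * \<nu>\<^sup>2) ^ n" using n nu2 by simp
    moreover have "(real n * \<nu>\<^sup>2 / 2)\<^sup>2 = 1 / 4" using n nu2 by (simp add: power_divide)
    moreover have "(sqrt (real n) / 40)\<^sup>2 \<le> (real g)\<^sup>2" using g(1) sqrt by (intro power_mono) auto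
    ultimately show "(sqrt (real n) / 40)\<^sup>2 * (1 / 4 * exp (- 64)) \<le>
        (real g)\<^sup>2 * ((real n * \<nu>\<^sup>2 / 2)\<^sup>2 * (1 - 32 * \<nu>\<^sup>2) ^ n)"
      by (intro mult_mono) auto
    then show "0 < (real g)\<^sup>2 * ((real n * \<nu>\<^sup>2 / 2)\<^sup>2 * (1 - 32 * \<nu>\<^sup>2) ^ n) *
        ((sqrt (real n) / 40)\<^sup>2 * (1 / 4 * exp (- 64)))"
      using n nu2 g by (intro mult_pos_pos) auto
  qed auto
  ultimately show ?thesis by (simp add: nu2)
qed

text \<open>\<open>A\<close> bounds the rounded-up \<open>m\<close> from above and \<open>q\<close>
  bounds the area of the pattern region, so the error is an explicit function of \<open>n\<close>
  without rounding and without \<open>r\<close>.\<close>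

lemma cop_prob_dense:
  fixes n :: nat and r :: real
  defines "L \<equiv> ln (real n)"
  defines "A \<equiv> L powr (3 / 4) + 1"
  defines "q \<equiv> 11520 * sqrt L / real n"
  assumes r: "1 / sqrt (real n) \<le> r" "r \<le> L / sqrt (real n)"
    and n: "n > 0" "L > 0" "L powr (3 / 4) \<ge> 16" "2 * A \<le> real n" "q \<le> 1 / 2" "2 * A * q < 1"
      "4 * (L / sqrt (real n)) * A \<le> 1"
  shows "cop_prob n r \<ge>
    1 - (1 / ((sqrt (real n) / (4 * L * A))\<^sup>2 * ((1 / (2 * A ^ 4)) powr A * exp (- 2 * q * real n)))
      + (1 / (1 - 2 * A * q) - 1))"
proof -
  define m where "m = nat \<lceil>L powr (3 / 4)\<rceil>"
  have m: "L powr (3 / 4) \<le> real m" "real m \<le> A" unfolding m_def A_def using n(3) by linarith+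
  have "m \<ge> 16" using m(1) n(3) by linarith
  have "0 < 1 / sqrt (real n)" using n by simp
  then have "r > 0" using r by linarith
  interpret rgg_polygon r m by standard (use \<open>r > 0\<close> \<open>m \<ge> 16\<close> in auto)
  have "A > 0" using m m_real by linarith
  have rn: "1 \<le> real n * r\<^sup>2" "real n * r\<^sup>2 \<le> L\<^sup>2"
  proof -
    have "1 \<le> sqrt (real n) * r" "sqrt (real n) * r \<le> L"
      using r n by (simp_all add: field_simps)
    then have "1\<^sup>2 \<le> (sqrt (real n) * r)\<^sup>2" "(sqrt (real n) * r)\<^sup>2 \<le> L\<^sup>2"
      using \<open>r > 0\<close> by (intro power_mono; simp)+
    then show "1 \<le> real n * r\<^sup>2" "real n * r\<^sup>2 \<le> L\<^sup>2" by (simp_all add: power_mult_distrib)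
  qed
  have q_ge: "11520 * r\<^sup>2 / (real m)\<^sup>2 \<le> q"
  proof -
    \<comment> \<open>Here the exponent 3/4 acts: n r^2 / m^2 \<le> L^2 / L^(3/2) = sqrt L.\<close>
    have "(L powr (3 / 4))\<^sup>2 = L powr (3 / 2)" by (simp add: powr_powr flip: powr_numeral)
    moreover have "L\<^sup>2 = sqrt L * L powr (3 / 2)"
      using n(2) by (simp add: powr_half_sqrt[symmetric] flip: powr_add powr_numeral)
    ultimately have "L\<^sup>2 \<le> sqrt L * (real m)\<^sup>2"
      using m(1) n(2) power_mono[OF m(1), of 2] by (simp add: mult_left_mono)
    with rn(2) have "real n * r\<^sup>2 \<le> sqrt L * (real m)\<^sup>2" by linarith
    then show ?thesis using n(1) m_real by (simp add: q_def field_simps)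
  qed
  have "q \<ge> 0" using n by (simp add: q_def)
  define y where "y = 1 / (2 * (r * real m))"
  have rm: "r * real m \<le> L / sqrt (real n) * A"
    using r m \<open>r > 0\<close> \<open>A > 0\<close> by (intro mult_mono) auto
  then have "4 * (r * real m) \<le> 1" using n(7) by simp
  moreover have "r * real m > 0" using \<open>r > 0\<close> m_real by simp
  ultimately have "y \<ge> 2" by (simp add: y_def field_simps)
  define g where "g = nat \<lfloor>y\<rfloor>"
  note g = nat_floor_ge_half[OF \<open>y \<ge> 2\<close>, folded g_def]
  have B: "2 * (r * real m) * real g \<le> 1"
    using g(3) \<open>r * real m > 0\<close> by (simp add: y_def field_simps)
  have "2 * real m * q \<le> 2 * A * q" using m \<open>q \<ge> 0\<close> by (intro mult_right_mono) auto
  with n have mq: "2 * real m * q < 1" by linarith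
  have "2 * real m \<le> real n" using m n by linarith
  then have mn: "2 * m \<le> n" by linarith
  have "emeasure lborel (Q t) \<le> ennreal q" for t
    using emeasure_Q[of t] ennreal_leI[OF q_ge] by (rule order_trans)
  then have "cop_prob n r \<ge> 1 - (1 / ((real g)\<^sup>2 * ((real n * \<eta>\<^sup>2 / 2) ^ m * (1 - q) ^ n))
      + (1 / (1 - 2 * real m * q) - 1))"
    by (intro rgg_cop_number_gt_1_bound[where Ps = Ps and Q = Q, OF g(2) B _ length_Ps Ps_facts Ps_disjoint
          Q_borel _ Q_box escape mn])
      (use \<open>r * real m > 0\<close> eta_pos n \<open>q \<ge> 0\<close> mq in auto)
  moreover have "1 / ((real g)\<^sup>2 * ((real n * \<eta>\<^sup>2 / 2) ^ m * (1 - q) ^ n)) \<le>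
     1 / ((sqrt (real n) / (4 * L * A))\<^sup>2 * ((1 / (2 * A ^ 4)) powr A * exp (- 2 * q * real n)))"
  proof (rule divide_left_mono)
    have e: "exp (- 2 * q * real n) \<le> (1 - q) ^ n"
      using n \<open>q \<ge> 0\<close> by (intro exp_le_one_minus_power) auto
    have gg: "sqrt (real n) / (4 * L * A) \<le> real g"
    proof -
      have "sqrt (real n) / (4 * L * A) = 1 / (4 * (L / sqrt (real n) * A))" by simp
      also have "\<dots> \<le> 1 / (4 * (r * real m))"
        using rm \<open>r * real m > 0\<close> n \<open>A > 0\<close> \<open>r > 0\<close> \<open>m \<ge> 16\<close> by (intro divide_left_mono mult_pos_pos) auto
      also have "\<dots> = y / 2" by (simp add: y_def)
      finally show ?thesis using g(1) by linarith
    qed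
    have "A ^ 4 \<ge> 1" using m m_real by (intro one_le_power) linarith
    then have A4: "1 / (2 * A ^ 4) \<le> 1" by (subst divide_le_eq_1_pos) linarith+
    \<comment> \<open>The base is at most 1, so raising the exponent from \<open>m\<close> to
      \<open>A\<close> only lowers the power.\<close>
    have "(1 / (2 * A ^ 4)) powr A \<le> (1 / (2 * A ^ 4)) powr real m"
      using m \<open>A > 0\<close> A4 by (intro powr_mono') auto
    also have "\<dots> = (1 / (2 * A ^ 4)) ^ m" using \<open>A > 0\<close> by (simp add: powr_realpow)
    also have "\<dots> \<le> (real n * \<eta>\<^sup>2 / 2) ^ m"
    proof (rule power_mono)
      have "1 / (2 * A ^ 4) \<le> 1 / (2 * real m ^ 4)"
        using m m_real by (intro divide_left_mono mult_left_mono power_mono) auto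
      also have "\<dots> \<le> (real n * r\<^sup>2) / (2 * real m ^ 4)" using rn(1) by (intro divide_right_mono) auto
      also have "\<dots> = real n * \<eta>\<^sup>2 / 2" by (simp add: \<eta>_def power_divide flip: power_mult)
      finally show "1 / (2 * A ^ 4) \<le> real n * \<eta>\<^sup>2 / 2" .
    qed (use \<open>A > 0\<close> in auto)
    finally have p: "(1 / (2 * A ^ 4)) powr A \<le> (real n * \<eta>\<^sup>2 / 2) ^ m" .
    have "(sqrt (real n) / (4 * L * A))\<^sup>2 \<le> (real g)\<^sup>2"
      using gg n \<open>A > 0\<close> by (intro power_mono) auto
    with e p show "(sqrt (real n) / (4 * L * A))\<^sup>2 * ((1 / (2 * A ^ 4)) powr A * exp (- 2 * q * real n))
       \<le> (real g)\<^sup>2 * ((real n * \<eta>\<^sup>2 / 2) ^ m * (1 - q) ^ n)"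
      using n \<open>q \<ge> 0\<close> by (intro mult_mono) auto
    show "0 < (real g)\<^sup>2 * ((real n * \<eta>\<^sup>2 / 2) ^ m * (1 - q) ^ n) *
        ((sqrt (real n) / (4 * L * A))\<^sup>2 * ((1 / (2 * A ^ 4)) powr A * exp (- 2 * q * real n)))"
      using n g(2) eta_pos \<open>A > 0\<close> by (intro mult_pos_pos zero_less_power) auto
  qed auto
  moreover have "1 / (1 - 2 * real m * q) \<le> 1 / (1 - 2 * A * q)"
    using \<open>2 * real m * q \<le> 2 * A * q\<close> n mq by (intro divide_left_mono) auto
  ultimately show ?thesis by linarith
qed

theorem theorem6:
  "\<exists>K3 > (0::real). \<forall>r :: nat \<Rightarrow> real.
     (\<forall>n. r n > 0) \<longrightarrow>
     (\<forall>\<^sub>F n in sequentially. r n \<le> K3 * ln (real n) / sqrt (real n)) \<longrightarrow>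
     (\<lambda>n. measure (rgg_space n)
              {x \<in> space (rgg_space n). cop_number {..<n} (rgg_adj x (r n)) > 1})
       \<longlonglongrightarrow> 1"
\<comment> \<open>The constant 1 turns the hypothesis on \<open>r\<close> into n r^2 \<le> (ln
  n)^2.\<close>
proof (rule exI[of _ 1], intro conjI allI impI)
  fix r :: "nat \<Rightarrow> real"
  assume r_pos: "\<forall>n. r n > 0"
    and r_le: "\<forall>\<^sub>F n in sequentially. r n \<le> 1 * ln (real n) / sqrt (real n)"
  define \<delta>1 where "\<delta>1 n = 1 / ((sqrt (real n) / 40)\<^sup>2 * (1 / 4 * exp (- 64))) + (1 / (1 - 128 / real n) - 1)"
    for n
  define L where "L n = ln (real n)" for n
  define A where "A n = L n powr (3 / 4) + 1" for n
  define q where "q n = 11520 * sqrt (L n) / real n" for n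
  define \<delta>2 where "\<delta>2 n = 1 / ((sqrt (real n) / (4 * L n * A n))\<^sup>2 *
    ((1 / (2 * A n ^ 4)) powr A n * exp (- 2 * q n * real n))) + (1 / (1 - 2 * A n * q n) - 1)" for n
  have "\<delta>1 \<longlonglongrightarrow> 0" unfolding \<delta>1_def by real_asymp
  \<comment> \<open>The number of boxes is \<open>n\<close> up to powers of ln n. Against it stand
    exp(-O(A ln A)) and exp(-O(sqrt(ln n))), and both A ln A and sqrt(ln n) are o(ln n).\<close>
  moreover have "\<delta>2 \<longlonglongrightarrow> 0" unfolding \<delta>2_def A_def q_def L_def by real_asymp
  ultimately have "(\<lambda>n. max (\<delta>1 n) (\<delta>2 n)) \<longlonglongrightarrow> max 0 0" by (rule tendsto_max)
  then have lower: "(\<lambda>n. 1 - max (\<delta>1 n) (\<delta>2 n)) \<longlonglongrightarrow> 1"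
    using tendsto_diff[OF tendsto_const[of "1 :: real"]] by fastforce
  have "\<forall>\<^sub>F n in sequentially. L n > 0" unfolding L_def by real_asymp
  moreover have "\<forall>\<^sub>F n in sequentially. L n powr (3 / 4) \<ge> 16" unfolding L_def by real_asymp
  moreover have "\<forall>\<^sub>F n in sequentially. 2 * A n \<le> real n" unfolding A_def L_def by real_asymp
  moreover have "\<forall>\<^sub>F n in sequentially. q n \<le> 1 / 2" unfolding q_def L_def by real_asymp
  moreover have "\<forall>\<^sub>F n in sequentially. 2 * A n * q n < 1" unfolding q_def A_def L_def by real_asymp
  moreover have "\<forall>\<^sub>F n in sequentially. 4 * (L n / sqrt (real n)) * A n \<le> 1"
    unfolding A_def L_def by real_asymp
  ultimately have "\<forall>\<^sub>F n in sequentially. 1 - max (\<delta>1 n) (\<delta>2 n) \<le> cop_prob n (r n)"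
    using r_le eventually_ge_at_top[of 1600]
  proof eventually_elim
    case (elim n)
    \<comment> \<open>The case distinction is made for each \<open>n\<close> separately, because the
      sequence may switch regimes infinitely often; hence the maximum of both errors.\<close>
    show ?case
    proof (cases "r n \<le> 1 / sqrt (real n)")
      case True
      have "1 - \<delta>1 n \<le> cop_prob n (r n)"
        unfolding \<delta>1_def by (rule cop_prob_sparse) (use True r_pos elim in auto)
      then show ?thesis by linarith
    next
      case False
      have "1 - \<delta>2 n \<le> cop_prob n (r n)"
        unfolding \<delta>2_def A_def q_def L_def
        by (rule cop_prob_dense) (use False elim in \<open>auto simp: A_def q_def L_def\<close>)
      then show ?thesis by linarith
    qed
  qed
  moreover have "cop_prob n (r n) \<le> 1" for n
  proof -
    interpret prob_space "rgg_space n"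
      unfolding rgg_space_def by (rule prob_space_PiM) (rule prob_space_uniform_unit_square)
    show ?thesis by (rule prob_le_1)
  qed
  ultimately show "(\<lambda>n. cop_prob n (r n)) \<longlonglongrightarrow> 1"
    by (intro tendsto_sandwich[OF _ _ lower tendsto_const]) auto
qed simp

end
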